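(* Let $R_0=1.1619\ldots$ be the maximum radius $R$ for which the dihedral Enneper surface $\Sigma_1^5(R)$ of order $5$ remains embedded. For $v\in(0,\frac{\pi}{3})$ let $\chi(v)=h(v;\,4.24,\,4.15)$, where $$h(x;a,b)=\begin{cases}\dfrac{\exp\left(-\frac{a}{a^2-(x-b)^2}\right)}{e^{-1/a}} & \text{if } |x-b|<|a|,\\[2mm] 0&\text{otherwise.}\end{cases}$$ Then $\varphi(u,v)=u\,\chi(v)$, with $v$ restricted to $(0,\frac{\pi}{3})$, destabilizes $\Sigma_1^5(R_0)$, i.e. $$\int_0^{R_0}\int_0^{\pi/3}\left(g^{ij}\varphi_i\varphi_j+2\kappa\varphi^2\right)\sqrt{|g|}\,dv\,du<0 .$$ Moreover, $$\mathrm{ind}_b(\Sigma_1^5(R_0))\ge 6.$$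
   Context: The dihedral Enneper surface $\Sigma_1^n(R)$ of order $n$ and radius $R$ is the minimal surface with patch $$\sigma(u,v)=\left(\frac{u\beta\cos v-u^{\beta}\cos(\beta v)}{2\beta},\ \frac{-u\beta\sin v-u^{\beta}\sin(\beta v)}{2\beta},\ \frac{u^{n+1}\cos((n+1)v)}{n+1}\right),\qquad \beta=2n+1,$$ where $(u,v)$ are polar coordinates, $0<u<R$, $v\in(0,2\pi)$, on the disc $\Omega(R)$ of radius $R$ (functions on $\Omega(R)$ are $2\pi$-periodic in $v$). Let $g=(g_{ij})$ be the induced metric in the coordinates $(u,v)$, $(g^{ij})$ its inverse, $|g|=\det(g_{ij})$, $\kappa$ the Gaussian curvature; subscripts on $\varphi$ denote partial derivatives in $(u,v)$ and repeated indices are summed. The second variation of area in the direction of the normal variation $\sigma+t\varphi\mathbf N$ ($\mathbf N$ the unit normal) is $$Q(\varphi)=\int\left(g^{ij}\varphi_i\varphi_j+2\kappa\varphi^2\right)\sqrt{|g|}\,du\,dv .$$ A test function destabilizes the surface if its second variation is negative; for a test function given on a slice of the parameter domain the integral is taken over that slice. $\mathcal F(\Omega(R))$ is the set of functions, smooth in $(u,v)$ for $0<u<R$, lying in the Sobolev space $\mathcal H^1$ of the disc $\Omega(R)$, whose partial derivatives of order at most $2$ in $(u,v)$ are bounded. $\mathrm{ind}_b(\Sigma_1^n(R))$ is the maximal dimension of a linear subspace of $\mathcal F(\Omega(R))$ on which $Q$ is negative definite.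
   Formalization: The printed value R_0=1.1619… is incorrect: the maximum embedded radius is 1.16168…, as double points already occur at radius below 1.1617. The formal statement asserts 1.1616 ≤ R_0 < 1.1617 instead; all other claims are unchanged. *)

theory Defs
  imports "HOL-Analysis.Analysis" "HOL-Library.Function_Algebras"
begin

section \<open>Functions as vectors\<close>

instantiation "fun" :: (type, real_vector) real_vector
begin

definition scaleR_fun_def: "scaleR c f = (\<lambda>x. c *\<^sub>R f x)"

instance
  by standard (simp_all add: scaleR_fun_def fun_eq_iff scaleR_add_right scaleR_add_left)

end


section \<open>Partial derivatives and smoothness\<close>

text \<open>The elements \<open>1\<close> and \<open>2\<close> of the index type \<open>2\<close> stand for the first and the second variable.\<close>

definition partial :: "2 \<Rightarrow> (real \<Rightarrow> real \<Rightarrow> 'a::real_normed_vector) \<Rightarrow> real \<Rightarrow> real \<Rightarrow> 'a" where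
  "partial i f u v =
     (if i = 1 then vector_derivative (\<lambda>s. f s v) (at u)
      else vector_derivative (\<lambda>t. f u t) (at v))"

fun partials :: "2 list \<Rightarrow> (real \<Rightarrow> real \<Rightarrow> 'a::real_normed_vector) \<Rightarrow> real \<Rightarrow> real \<Rightarrow> 'a" where
  "partials [] f = f"
| "partials (i # is) f = partial i (partials is f)"

text \<open>On an open set: all iterated partial derivatives exist and are continuous. Differentiability
  is required separately since \<^const>\<open>vector_derivative\<close> is total.\<close>

definition smooth_on :: "(real \<times> real) set \<Rightarrow> (real \<Rightarrow> real \<Rightarrow> 'a::real_normed_vector) \<Rightarrow> bool" where
  "smooth_on U f \<longleftrightarrow>
     (\<forall>is. continuous_on U (\<lambda>(u, v). partials is f u v) \<and>
        (\<forall>(u, v)\<in>U. (\<lambda>s. partials is f s v) differentiable (at u) \<and>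
                    (\<lambda>t. partials is f u t) differentiable (at v)))"


section \<open>Geometry of a patch\<close>

definition metric :: "(real \<Rightarrow> real \<Rightarrow> real^3) \<Rightarrow> real \<Rightarrow> real \<Rightarrow> real^2^2" where
  "metric \<sigma> u v = (\<chi> i j. partial i \<sigma> u v \<bullet> partial j \<sigma> u v)"

definition unit_normal :: "(real \<Rightarrow> real \<Rightarrow> real^3) \<Rightarrow> real \<Rightarrow> real \<Rightarrow> real^3" where
  "unit_normal \<sigma> u v = sgn (cross3 (partial 1 \<sigma> u v) (partial 2 \<sigma> u v))"

definition second_form :: "(real \<Rightarrow> real \<Rightarrow> real^3) \<Rightarrow> real \<Rightarrow> real \<Rightarrow> real^2^2" where
  "second_form \<sigma> u v = (\<chi> i j. partial i (partial j \<sigma>) u v \<bullet> unit_normal \<sigma> u v)"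

definition gauss_curvature :: "(real \<Rightarrow> real \<Rightarrow> real^3) \<Rightarrow> real \<Rightarrow> real \<Rightarrow> real" where
  "gauss_curvature \<sigma> u v = det (second_form \<sigma> u v) / det (metric \<sigma> u v)"

definition second_variation ::
  "(real \<Rightarrow> real \<Rightarrow> real^3) \<Rightarrow> (real \<times> real) set \<Rightarrow> (real \<Rightarrow> real \<Rightarrow> real) \<Rightarrow> real" where
  "second_variation \<sigma> D \<phi> =
     (LINT (u, v):D|lborel.
        ((\<Sum>i\<in>UNIV. \<Sum>j\<in>UNIV.
            matrix_inv (metric \<sigma> u v) $ i $ j * partial i \<phi> u v * partial j \<phi> u v)
          + 2 * gauss_curvature \<sigma> u v * (\<phi> u v)\<^sup>2)
        * sqrt (det (metric \<sigma> u v)))"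


section \<open>Sobolev space of a planar domain\<close>

definition test_function :: "(real \<times> real) set \<Rightarrow> (real \<Rightarrow> real \<Rightarrow> real) \<Rightarrow> bool" where
  "test_function \<Omega> \<psi> \<longleftrightarrow>
     smooth_on UNIV \<psi> \<and> (\<exists>K. compact K \<and> K \<subseteq> \<Omega> \<and> (\<forall>x y. (x, y) \<notin> K \<longrightarrow> \<psi> x y = 0))"

definition L2_space :: "(real \<times> real) set \<Rightarrow> (real \<times> real \<Rightarrow> real) set" where
  "L2_space \<Omega> = {f. set_borel_measurable lborel \<Omega> f \<and> set_integrable lborel \<Omega> (\<lambda>p. (f p)\<^sup>2)}"

definition weak_partial ::
  "2 \<Rightarrow> (real \<times> real) set \<Rightarrow> (real \<times> real \<Rightarrow> real) \<Rightarrow> (real \<times> real \<Rightarrow> real) \<Rightarrow> bool" where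
  "weak_partial i \<Omega> f w \<longleftrightarrow>
     (\<forall>\<psi>. test_function \<Omega> \<psi> \<longrightarrow>
        (LINT (x, y):\<Omega>|lborel. f (x, y) * partial i \<psi> x y)
          = - (LINT (x, y):\<Omega>|lborel. w (x, y) * \<psi> x y))"

definition H1_space :: "(real \<times> real) set \<Rightarrow> (real \<times> real \<Rightarrow> real) set" where
  "H1_space \<Omega> = {f \<in> L2_space \<Omega>. \<forall>i. \<exists>w \<in> L2_space \<Omega>. weak_partial i \<Omega> f w}"


section \<open>Dihedral Enneper surfaces\<close>

definition enneper :: "nat \<Rightarrow> real \<Rightarrow> real \<Rightarrow> real^3" where
  "enneper n u v =
     (let b = 2 * n + 1; \<beta> = real b in
      vector [(u * \<beta> * cos v - u ^ b * cos (\<beta> * v)) / (2 * \<beta>),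
              (- u * \<beta> * sin v - u ^ b * sin (\<beta> * v)) / (2 * \<beta>),
              u ^ (n + 1) * cos (real (n + 1) * v) / real (n + 1)])"

definition disc :: "real \<Rightarrow> (real \<times> real) set" where
  "disc R = ball (0, 0) R"

text \<open>The function of the Cartesian coordinates given by a \<open>2\<pi>\<close>-periodic function of the polar
  ones. At the origin it takes the value at \<open>(0, 0)\<close>, which is \<open>0\<close> for the Enneper patch, the limit
  there.\<close>

definition on_disc :: "(real \<Rightarrow> real \<Rightarrow> 'a) \<Rightarrow> real \<times> real \<Rightarrow> 'a" where
  "on_disc f = (\<lambda>(x, y). f (sqrt (x\<^sup>2 + y\<^sup>2)) (Arg2pi (Complex x y)))"

text \<open>Immersion and homeomorphism onto the image. Smoothness holds for every Enneper surface:
  the coordinates are polynomials in \<open>x\<close> and \<open>y\<close>.\<close>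

definition enneper_embedded :: "nat \<Rightarrow> real \<Rightarrow> bool" where
  "enneper_embedded n R \<longleftrightarrow>
     (\<forall>p \<in> disc R. \<exists>X'. (on_disc (enneper n) has_derivative X') (at p) \<and> inj X') \<and>
     embedding_map (top_of_set (disc R)) euclidean (on_disc (enneper n))"

text \<open>For order \<open>5\<close> the maximum is
  \<open>(min {- 11 sin v / sin (11 v) | v. sin v > 0 \<and> sin (11 v) < 0}) ^ (1 / 10)\<close>, which is
  \<open>4.47602\<dots> ^ (1 / 10) = 1.16168\<dots>\<close>; the value \<open>1.1619\<dots>\<close> in the literature has an inexact
  fourth decimal.\<close>

definition max_embedded_radius :: "nat \<Rightarrow> real \<Rightarrow> bool" where
  "max_embedded_radius n R \<longleftrightarrow>
     0 < R \<and> enneper_embedded n R \<and> (\<forall>R' > 0. enneper_embedded n R' \<longrightarrow> R' \<le> R)"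

text \<open>Elements of the function space are functions on the punctured disc, so they are fixed to be
  \<open>0\<close> where \<open>u\<close> is not in the range of radii; this makes equality of functions the right one for
  linear independence. No condition is imposed at the boundary \<open>u = R\<close>.\<close>

definition function_space :: "real \<Rightarrow> (real \<Rightarrow> real \<Rightarrow> real) set" where
  "function_space R = {\<phi>.
     (\<forall>u v. \<phi> u (v + 2 * pi) = \<phi> u v) \<and>
     (\<forall>u v. u \<notin> {0<..<R} \<longrightarrow> \<phi> u v = 0) \<and>
     smooth_on ({0<..<R} \<times> UNIV) \<phi> \<and>
     on_disc \<phi> \<in> H1_space (disc R) \<and>
     (\<forall>is. length is \<le> 2 \<longrightarrow> bounded ((\<lambda>(u, v). partials is \<phi> u v) ` ({0<..<R} \<times> UNIV)))}"

definition enneper_Q :: "nat \<Rightarrow> real \<Rightarrow> (real \<Rightarrow> real \<Rightarrow> real) \<Rightarrow> real" where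
  "enneper_Q n R = second_variation (enneper n) ({0<..<R} \<times> {0<..<2 * pi})"

text \<open>\<^const>\<open>dim\<close> is \<open>0\<close> on infinite-dimensional subspaces; these contribute to the supremum through
  their finite-dimensional subspaces.\<close>

definition ind_b :: "nat \<Rightarrow> real \<Rightarrow> enat" where
  "ind_b n R =
     (SUP S \<in> {S. subspace S \<and> S \<subseteq> function_space R \<and> (\<forall>\<phi>\<in>S. \<phi> \<noteq> 0 \<longrightarrow> enneper_Q n R \<phi> < 0)}.
        enat (dim S))"

definition bump :: "real \<Rightarrow> real \<Rightarrow> real \<Rightarrow> real" where
  "bump x a b =
     (if \<bar>x - b\<bar> < \<bar>a\<bar> then exp (- (a / (a\<^sup>2 - (x - b)\<^sup>2))) / exp (- (1 / a)) else 0)"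

end

theory Submission
  imports Defs
begin

text \<open>
  In the complex coordinate \<open>z = u e\<^sup>i\<^sup>v\<close> a double point \<open>z \<noteq> w\<close> of the surface of order \<open>n\<close> satisfies
  \<open>(2 n + 1) (z - w) = cnj (z\<^sup>2\<^sup>n\<^sup>+\<^sup>1 - w\<^sup>2\<^sup>n\<^sup>+\<^sup>1)\<close> and \<open>Re z\<^sup>n\<^sup>+\<^sup>1 = Re w\<^sup>n\<^sup>+\<^sup>1\<close>. Writing \<open>z = exp (c + \<zeta>)\<close> and
  \<open>w = exp (c - \<zeta>)\<close>, these equations make \<open>sinh (n \<zeta>) / sinh ((n + 1) \<zeta>)\<close> real and of modulus greater
  than \<open>1\<close>, which is only possible if \<open>\<zeta>\<close> is imaginary. Hence double points have equal moduli \<open>r\<close>, and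
  \<open>r\<^sup>2\<^sup>n = - (2 n + 1) sin \<theta> / sin ((2 n + 1) \<theta>)\<close> where \<open>2 \<theta>\<close> is the difference of the angles. The maximal
  radius is the infimum of these \<open>r\<close>.

  For the index, the harmonic polynomials \<open>\<Sum>k\<le>3. u\<^sup>k (a\<^sub>k cos (k v) + b\<^sub>k sin (k v))\<close> without constant term
  form a space of dimension \<open>6\<close> on which the second variation is diagonal, with negative entries.
\<close>

section \<open>Double points\<close>

text \<open>Equality of the moduli is used twice. It reduces the equations to a relation for one
  radius, and it settles the topology: injectivity on an open disc does not give a homeomorphism
  onto the image, since points near the rim could return to the image of an interior point, and
  equal moduli exclude this. As the disc is open, the infimum itself is an embedded radius. For
  order \<open>5\<close>, minimising a Dirichlet kernel places it between \<open>1.1616\<close> and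
  \<open>1.1617\<close>; this bracket is all that the two instability estimates see of the radius.
  The coordinate \<open>z\<close> is conformal and the Dirichlet integral is conformally invariant,
  so the second variation is a flat Dirichlet energy minus the square of the function against a
  weight in \<open>u\<close> alone. Hence the Fourier modes decouple: up to a common factor, mode
  \<open>k\<close> contributes \<open>k * R ^ (2 * k)\<close> minus the integral of the weight times
  \<open>u ^ (2 * k)\<close>. Degree \<open>3\<close> is as far as the elementary lower bound for
  that integral reaches.\<close>

lemma Re_sinh: "Re (sinh z) = sinh (Re z) * cos (Im z)"
  and Im_sinh: "Im (sinh z) = cosh (Re z) * sin (Im z)"
  by (simp_all add: sinh_field_def cosh_field_def Re_exp Im_exp field_simps)

text \<open>Here \<open>z\<^sup>n\<^sup>+\<^sup>1 - w\<^sup>n\<^sup>+\<^sup>1\<close> is imaginary by the height coordinate, and the other two coordinates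
  make the square of \<open>\<surd>(z w) (z\<^sup>n - w\<^sup>n)\<close> a larger negative number.\<close>

lemma double_point_norm_eq:
  fixes z w :: complex
  assumes n: "n > 0" and "z \<noteq> w"
    and F: "of_nat (2 * n + 1) * (z - w) = cnj (z ^ (2 * n + 1) - w ^ (2 * n + 1))"
    and H: "Re (z ^ (n + 1)) = Re (w ^ (n + 1))"
  shows "norm z = norm w" and "z \<noteq> 0"
proof -
  define N where "N = 2 * n + 1"
  define h where "h = Im (z ^ (n + 1) - w ^ (n + 1))"
  have h: "z ^ (n + 1) - w ^ (n + 1) = \<i> * of_real h"
    using H by (simp add: h_def complex_eq_iff)
  define D where "D = z ^ N - w ^ N"
  have FD: "of_nat N * (z - w) = cnj D"
    using F by (simp add: N_def D_def)
  have "D \<noteq> 0"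
  proof
    assume "D = 0"
    with FD have "of_nat N * (z - w) = 0" by simp
    then have "of_nat N = (0::complex)" using \<open>z \<noteq> w\<close> by auto
    then show False unfolding N_def of_nat_eq_0_iff by simp
  qed
  \<comment> \<open>As \<open>N * (z - w)\<close> is the conjugate of \<open>D\<close>, the product
    \<open>(z - w) * D\<close> is the positive real \<open>p\<close>.\<close>
  define p where "p = (norm D)\<^sup>2 / real N"
  have p: "p > 0"
    using \<open>D \<noteq> 0\<close> by (simp add: p_def N_def)
  have N0: "of_nat N \<noteq> (0::complex)" by (simp add: N_def del: of_nat_Suc)
  have "of_nat N * ((z - w) * D) = D * cnj D"
    using FD by (simp add: mult_ac)
  also have "\<dots> = of_real ((norm D)\<^sup>2)"
    by (simp only: complex_norm_square)
  finally have zwD: "(z - w) * D = of_real p"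
    using N0 by (simp add: p_def field_simps)
  \<comment> \<open>This identity joins the height equation, which makes the first square
    \<open>- h\<^sup>2\<close>, with the planar one, which makes the product
    \<open>p\<close>.\<close>
  have "z * w * (z ^ n - w ^ n)\<^sup>2 = (z ^ (n + 1) - w ^ (n + 1))\<^sup>2 - (z - w) * D"
  proof -
    have "z ^ (n + 1) = z * z ^ n" "w ^ (n + 1) = w * w ^ n"
      "z ^ N = z * (z ^ n * z ^ n)" "w ^ N = w * (w ^ n * w ^ n)"
      by (simp_all add: N_def mult_2 power_add)
    moreover have "x * y * (a - b)\<^sup>2 = (x * a - y * b)\<^sup>2 - (x - y) * (x * (a * a) - y * (b * b))"
      for x y a b :: complex
      by algebra
    ultimately show ?thesis unfolding D_def by simp
  qed
  also have "\<dots> = - of_real (h\<^sup>2 + p)"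
    unfolding h zwD by (simp add: power_mult_distrib)
  finally have key: "z * w * (z ^ n - w ^ n)\<^sup>2 = - of_real (h\<^sup>2 + p)" .
  have pos: "h\<^sup>2 + p > 0" using p by (simp add: add_nonneg_pos)
  then have ne: "z * w * (z ^ n - w ^ n)\<^sup>2 \<noteq> 0"
    unfolding key by (metis of_real_eq_0_iff neg_equal_0_iff_equal less_irrefl)
  then have z0: "z \<noteq> 0" and w0: "w \<noteq> 0" by auto
  then show "z \<noteq> 0" by blast
  \<comment> \<open>Half the sum and half the difference of the logarithms:
    \<open>z ^ m - w ^ m\<close> becomes \<open>2 * exp (m * c) * sinh (m * \<zeta>)\<close>, and
    \<open>z * w = exp (2 * c)\<close> lets the exponents \<open>n\<close> and \<open>n + 1\<close>
    share the factor \<open>e\<close>.\<close>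
  define c \<zeta> where "c = (Ln z + Ln w) / 2" and "\<zeta> = (Ln z - Ln w) / 2"
  have z: "z = exp (c + \<zeta>)" and w: "w = exp (c - \<zeta>)"
    using z0 w0 by (auto simp: c_def \<zeta>_def field_simps add_divide_distrib[symmetric] diff_divide_distrib[symmetric])
  have pw: "z ^ m - w ^ m = 2 * exp (of_nat m * c) * sinh (of_nat m * \<zeta>)" for m
  proof -
    have "z ^ m = exp (of_nat m * c) * exp (of_nat m * \<zeta>)"
      by (simp add: z exp_add exp_of_nat_mult power_mult_distrib)
    moreover have "w ^ m = exp (of_nat m * c) * exp (- (of_nat m * \<zeta>))"
      unfolding mult_minus_right[symmetric] exp_of_nat_mult
      by (simp only: w diff_conv_add_uminus exp_add power_mult_distrib)
    ultimately show ?thesis by (simp only: sinh_field_def) (simp add: algebra_simps)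
  qed
  define e where "e = exp (of_nat (n + 1) * c)"
  define S T where "S = sinh (of_nat (n + 1) * \<zeta>)" and "T = sinh (of_nat n * \<zeta>)"
  have S: "2 * e * S = \<i> * of_real h"
    using pw[of "n+1"] h by (simp add: e_def S_def)
  define k where "k = sqrt (h\<^sup>2 + p)"
  have k2: "k\<^sup>2 = h\<^sup>2 + p" using pos by (simp add: k_def)
  have "(2 * e * T)\<^sup>2 = z * w * (z ^ n - w ^ n)\<^sup>2"
  proof -
    have "z * w = exp (2 * c)" by (simp add: z w flip: exp_add)
    moreover have "e\<^sup>2 = exp (2 * c) * (exp (of_nat n * c))\<^sup>2"
      by (simp add: e_def algebra_simps power2_eq_square flip: exp_add)
    ultimately show ?thesis unfolding pw T_def by (simp add: power_mult_distrib)
  qed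
  also have "\<dots> = (\<i> * of_real k)\<^sup>2"
    unfolding key k2[symmetric] by (simp add: power_mult_distrib)
  finally have T: "2 * e * T = \<i> * of_real k \<or> 2 * e * T = - (\<i> * of_real k)"
    by (simp add: power2_eq_iff)
  have e0: "e \<noteq> 0" by (simp add: e_def)
  \<comment> \<open>Only the square of \<open>2 * e * T\<close> is known, so \<open>h'\<close> is
    \<open>h\<close> up to sign.\<close>
  obtain h' where h': "\<bar>h'\<bar> = \<bar>h\<bar>" and ST: "of_real k * S = of_real h' * T"
  proof -
    have "2 * e * (of_real k * S) = of_real k * (2 * e * S)" by (simp only: mult_ac)
    also have "\<dots> = of_real h * (\<i> * of_real k)" unfolding S by (simp only: mult_ac)
    also have "\<dots> = 2 * e * (of_real h * T) \<or> \<dots> = 2 * e * (of_real (- h) * T)"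
    proof -
      have eT: "2 * e * (of_real c * T) = of_real c * (2 * e * T)" for c by (simp only: mult_ac)
      from T show ?thesis unfolding eT by auto
    qed
    finally have "of_real k * S = of_real h * T \<or> of_real k * S = of_real (- h) * T"
      using e0 by (metis mult_left_cancel mult_eq_0_iff zero_neq_numeral)
    then show ?thesis using that[of h] that[of "-h"] by auto
  qed
  have h'2: "h'\<^sup>2 = h\<^sup>2"
    using h' by (metis power2_abs)
  define \<tau> \<theta> where "\<tau> = Re \<zeta>" and "\<theta> = Im \<zeta>"
  have "\<tau> = 0"
  proof (rule ccontr)
    assume t0: "\<tau> \<noteq> 0"
    have re: "k * (sinh ((n+1) * \<tau>) * cos ((n+1) * \<theta>)) = h' * (sinh (n * \<tau>) * cos (n * \<theta>))"
      using arg_cong[OF ST, of Re] unfolding S_def T_def \<tau>_def \<theta>_def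
      by (simp add: Re_sinh del: of_nat_Suc of_nat_add)
    have im: "k * (cosh ((n+1) * \<tau>) * sin ((n+1) * \<theta>)) = h' * (cosh (n * \<tau>) * sin (n * \<theta>))"
      using arg_cong[OF ST, of Im] unfolding S_def T_def \<tau>_def \<theta>_def
      by (simp add: Im_sinh del: of_nat_Suc of_nat_add)
    have mono: "sinh (n * \<bar>\<tau>\<bar>) \<le> sinh ((n+1) * \<bar>\<tau>\<bar>)" "cosh (n * \<bar>\<tau>\<bar>) \<le> cosh ((n+1) * \<bar>\<tau>\<bar>)"
      by (auto simp: mult_right_mono cosh_real_nonneg_le_iff)
    have sq: "(sinh (m * \<tau>))\<^sup>2 = (sinh (m * \<bar>\<tau>\<bar>))\<^sup>2" "(cosh (m * \<tau>))\<^sup>2 = (cosh (m * \<bar>\<tau>\<bar>))\<^sup>2" for m :: nat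
      by (auto simp: abs_if)
    have s0: "0 < sinh (n * \<bar>\<tau>\<bar>)" and c0: "0 < cosh (n * \<bar>\<tau>\<bar>)"
      using n t0 by auto
    have s: "(sinh (n * \<bar>\<tau>\<bar>))\<^sup>2 \<le> (sinh ((n+1) * \<bar>\<tau>\<bar>))\<^sup>2"
      and c: "(cosh (n * \<bar>\<tau>\<bar>))\<^sup>2 \<le> (cosh ((n+1) * \<bar>\<tau>\<bar>))\<^sup>2"
      using mono s0 c0 by (auto intro!: power_mono)
    \<comment> \<open>Real and imaginary parts are treated separately: the hyperbolic factor is at
      least as large at \<open>n + 1\<close> as at \<open>n\<close>, so dropping it leaves an
      inequality between the squared cosines, and one between the squared sines. Their sum is
      \<open>k\<^sup>2 \<le> h\<^sup>2\<close>, against \<open>p > 0\<close>.\<close>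
    have comparison: "X \<le> Y" if "X * A = Y * B" "0 < B" "B \<le> A" "0 \<le> X" for X Y A B :: real
    proof -
      have "X * B \<le> Y * B" using that mult_left_mono[of B A X] by simp
      then show ?thesis using that by simp
    qed
    have "k\<^sup>2 * (cos ((n+1) * \<theta>))\<^sup>2 \<le> h\<^sup>2 * (cos (n * \<theta>))\<^sup>2"
    proof (rule comparison[OF _ _ s])
      have "(k * (sinh ((n+1) * \<tau>) * cos ((n+1) * \<theta>)))\<^sup>2 = (h' * (sinh (n * \<tau>) * cos (n * \<theta>)))\<^sup>2"
        using re by simp
      then show "k\<^sup>2 * (cos ((n+1) * \<theta>))\<^sup>2 * (sinh ((n+1) * \<bar>\<tau>\<bar>))\<^sup>2 = h\<^sup>2 * (cos (n * \<theta>))\<^sup>2 * (sinh (n * \<bar>\<tau>\<bar>))\<^sup>2"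
        unfolding power_mult_distrib sq by (simp add: h'2 mult_ac)
    qed (use n t0 in auto)
    moreover have "k\<^sup>2 * (sin ((n+1) * \<theta>))\<^sup>2 \<le> h\<^sup>2 * (sin (n * \<theta>))\<^sup>2"
    proof (rule comparison[OF _ _ c])
      have "(k * (cosh ((n+1) * \<tau>) * sin ((n+1) * \<theta>)))\<^sup>2 = (h' * (cosh (n * \<tau>) * sin (n * \<theta>)))\<^sup>2"
        using im by simp
      then show "k\<^sup>2 * (sin ((n+1) * \<theta>))\<^sup>2 * (cosh ((n+1) * \<bar>\<tau>\<bar>))\<^sup>2 = h\<^sup>2 * (sin (n * \<theta>))\<^sup>2 * (cosh (n * \<bar>\<tau>\<bar>))\<^sup>2"
        unfolding power_mult_distrib sq by (simp add: h'2 mult_ac)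
    qed (use c0 in auto)
    ultimately have "k\<^sup>2 * ((cos ((n+1) * \<theta>))\<^sup>2 + (sin ((n+1) * \<theta>))\<^sup>2) \<le> h\<^sup>2 * ((cos (n * \<theta>))\<^sup>2 + (sin (n * \<theta>))\<^sup>2)"
      unfolding distrib_left by linarith
    then show False using k2 p by simp
  qed
  then show "norm z = norm w"
    by (simp add: z w \<tau>_def)
qed

text \<open>In the half sum \<open>\<alpha>\<close> and half difference \<open>\<theta>\<close> of
  the angles, the planar equation says that a nonzero real multiple of
  \<open>cis (2 * ((n + 1) * \<alpha>))\<close> is real, so this phase is \<open>1\<close> or
  \<open>- 1\<close>. The height equation ties the phase \<open>- 1\<close> to
  \<open>sin ((n + 1) * \<theta>) = 0\<close>; then
  \<open>sin (N * \<theta>) = - sin \<theta>\<close>, and a sum of two positive terms would have to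
  vanish.\<close>

lemma double_point_polar:
  fixes z w :: complex
  assumes n: "n > 0" and "z \<noteq> w"
    and F: "of_nat (2 * n + 1) * (z - w) = cnj (z ^ (2 * n + 1) - w ^ (2 * n + 1))"
    and H: "Re (z ^ (n + 1)) = Re (w ^ (n + 1))"
  obtains \<theta> where "sin \<theta> \<noteq> 0"
    and "norm z ^ (2 * n) * sin (real (2 * n + 1) * \<theta>) = - real (2 * n + 1) * sin \<theta>"
proof -
  note nz = double_point_norm_eq[OF assms]
  define r \<alpha> \<theta> where "r = norm z" and "\<alpha> = (Arg z + Arg w) / 2" and "\<theta> = (Arg z - Arg w) / 2"
  define N where "N = 2 * n + 1"
  have r: "r > 0" using nz(2) by (simp add: r_def)
  have "\<alpha> + \<theta> = Arg z" "\<alpha> - \<theta> = Arg w"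
    by (simp_all add: \<alpha>_def \<theta>_def field_simps)
  then have z: "z = r * cis (\<alpha> + \<theta>)" and w: "w = r * cis (\<alpha> - \<theta>)"
    using rcis_cmod_Arg[of z] rcis_cmod_Arg[of w] nz(1)
    unfolding r_def rcis_def by metis+
  have pw: "z ^ m - w ^ m = 2 * \<i> * r ^ m * cis (m * \<alpha>) * sin (m * \<theta>)" for m
    by (simp add: z w power_mult_distrib Complex.DeMoivre complex_eq_iff sin_add cos_add sin_diff cos_diff algebra_simps)
  have s0: "sin \<theta> \<noteq> 0"
    using pw[of 1] \<open>z \<noteq> w\<close> by auto
  have "real N * r * sin \<theta> * cis \<alpha> * (2 * \<i>) = - (r ^ N * sin (N * \<theta>) * cnj (cis (N * \<alpha>))) * (2 * \<i>)"
    using F pw[of 1] pw[of N] unfolding N_def[symmetric] by (simp add: mult_ac)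
  then have "real N * r * sin \<theta> * cis \<alpha> = - (r ^ N * sin (N * \<theta>) * cnj (cis (N * \<alpha>)))"
    by (rule mult_right_cancel[THEN iffD1, rotated]) simp
  then have "real N * r * sin \<theta> * cis \<alpha> * cis (N * \<alpha>) = - (r ^ N * sin (N * \<theta>) * cnj (cis (N * \<alpha>))) * cis (N * \<alpha>)"
    by (simp only:)
  then have "real N * r * sin \<theta> * cis \<alpha> * cis (N * \<alpha>) = - (r ^ N * sin (N * \<theta>) * (cnj (cis (N * \<alpha>)) * cis (N * \<alpha>)))"
    by (simp only: mult.assoc mult_minus_left)
  also have "cnj (cis (N * \<alpha>)) * cis (N * \<alpha>) = 1"
    by (simp add: cis_cnj cis_mult)
  finally have "of_real (real N * r * sin \<theta>) * (cis \<alpha> * cis (N * \<alpha>)) = of_real (- (r ^ N * sin (N * \<theta>)))"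
    by (simp add: mult.assoc)
  moreover have "cis \<alpha> * cis (N * \<alpha>) = cis (2 * ((n + 1) * \<alpha>))"
    by (simp add: cis_mult N_def algebra_simps)
  ultimately have E: "of_real (real N * r * sin \<theta>) * cis (2 * ((n + 1) * \<alpha>)) = of_real (- (r ^ N * sin (N * \<theta>)))"
    by simp
  have "sin ((n+1) * \<alpha>) * sin ((n+1) * \<theta>) = 0"
    using arg_cong[OF pw[of "n+1"], of Re] H r by simp
  then consider "sin ((n+1) * \<alpha>) = 0" | "cos ((n+1) * \<alpha>) = 0" "sin ((n+1) * \<theta>) = 0" | "sin ((n+1) * \<theta>) = 0" "sin (2 * ((n+1) * \<alpha>)) \<noteq> 0"
    by (auto simp: sin_double)
  then have "r ^ N * sin (N * \<theta>) = - real N * r * sin \<theta>"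
  proof cases
    case 1
    then have "cis (2 * ((n + 1) * \<alpha>)) = 1"
      by (simp add: complex_eq_iff cos_double_sin sin_double)
    then show ?thesis using E by (metis of_real_eq_iff mult.right_neutral minus_minus mult_minus_left)
  next
    case 2
    have "N * \<theta> = 2 * ((n + 1) * \<theta>) - \<theta>" by (simp add: N_def algebra_simps)
    then have "sin (N * \<theta>) = - sin \<theta>"
      using 2 by (simp add: sin_diff cos_double_sin sin_double)
    moreover have "cis (2 * ((n + 1) * \<alpha>)) = - 1"
      using 2 by (simp add: complex_eq_iff cos_double_cos sin_double)
    ultimately have "real N * r * sin \<theta> = - (r ^ N * sin \<theta>)"
      using arg_cong[OF E, of Re] by simp
    then have "(real N * r + r ^ N) * sin \<theta> = 0" by (simp add: algebra_simps)
    moreover have "real N * r + r ^ N > 0" using r by (simp add: add_nonneg_pos)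
    ultimately show ?thesis using s0 by simp
  next
    case 3
    then show ?thesis using arg_cong[OF E, of Im] s0 r by (simp add: N_def)
  qed
  then have "r * (r ^ (2 * n) * sin (N * \<theta>)) = r * (- real N * sin \<theta>)"
    by (simp add: N_def mult_ac)
  with r have "r ^ (2 * n) * sin (N * \<theta>) = - real N * sin \<theta>" by (metis less_irrefl mult_left_cancel)
  with s0 show ?thesis using that r_def N_def by blast
qed

section \<open>The minimum of the Dirichlet kernel for order \<open>5\<close>\<close>

definition dirichlet_poly :: "real \<Rightarrow> real" where
  "dirichlet_poly x = 1 + 6 * x - 12 * x^2 - 32 * x^3 + 16 * x^4 + 32 * x^5"

text \<open>\<open>dirichlet_poly\<close> is the Dirichlet kernel
  \<open>1 + 2 * (cos (2 * \<theta>) + ... + cos (10 * \<theta>))\<close> in the variable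
  \<open>cos (2 * \<theta>)\<close>, the Chebyshev polynomial of the fourth kind of degree
  \<open>5\<close>. The three-term recurrence for the sines of odd multiples, started at
  \<open>- 1\<close>, produces it.\<close>

lemma sin_11: "sin (11 * \<theta>) = sin \<theta> * dirichlet_poly (cos (2 * \<theta>))"
proof -
  define x where "x = cos (2 * \<theta>)"
  have step: "sin ((k + 4) * \<theta>) = 2 * x * sin ((k + 2) * \<theta>) - sin (k * \<theta>)" for k
  proof -
    have "sin ((k + 4) * \<theta>) = sin ((k + 2) * \<theta> + 2 * \<theta>)" "sin (k * \<theta>) = sin ((k + 2) * \<theta> - 2 * \<theta>)"
      by (simp_all add: algebra_simps)
    then show ?thesis by (simp add: sin_add sin_diff x_def)
  qed
  note step[of "-1", simplified] step[of 1, simplified] step[of 3, simplified]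
    step[of 5, simplified] step[of 7, simplified]
  then show ?thesis
    by (simp add: dirichlet_poly_def flip: x_def) (simp add: algebra_simps power2_eq_square power3_eq_cube eval_nat_numeral)
qed

text \<open>The square vanishes near the minimum \<open>x = 0.68275\<dots>\<close>, so the remainder is nearly constant.\<close>

lemma dirichlet_poly_lower:
  assumes "- 1 \<le> x" "x \<le> 1"
  shows "dirichlet_poly x \<ge> - (11 / 1.1616 ^ 10)"
proof -
  \<comment> \<open>For \<open>y \<ge> 0\<close> the cofactor obtained on division by
    \<open>(y - 1.68275)^2\<close> is easily seen to be positive: completing the square at
    \<open>0.56725 = 36.304 / 64\<close> leaves a positive constant.\<close>
  define y where "y = x + 1"
  have y: "0 \<le> y" "y \<le> 2" using assms by (auto simp: y_def)
  have "32 * y^3 - 36.304 * y^2 + 11.206166 * y = y * (32 * (y - 0.56725)^2 + (11.206166 - 32 * 0.56725^2))"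
    by (simp add: power2_eq_square power3_eq_cube algebra_simps)
  then have "0 \<le> 32 * y^3 - 36.304 * y^2 + 11.206166 * y"
    using y by (simp add: power2_eq_square)
  then have "0 \<le> (y - 1.68275)^2 * (32 * y^3 - 36.304 * y^2 + 11.206166 * y + 0.514484782)"
    by (intro mult_nonneg_nonneg) auto
  moreover have "dirichlet_poly x = (y - 1.68275)^2 * (32 * y^3 - 36.304 * y^2 + 11.206166 * y + 0.514484782)
      + (- 2.45753641416547965625 - 0.000414105049375 * (y - 1.68275))"
    by (simp add: dirichlet_poly_def y_def eval_nat_numeral field_simps)
  moreover have "- 2.45753641416547965625 - 0.000414105049375 * (y - 1.68275) \<ge> - (11 / 1.1616 ^ 10)"
  proof -
    have "- (11 / 1.1616 ^ 10) \<le> (- 2.459 :: real)" by (simp add: eval_nat_numeral)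
    also have "\<dots> \<le> - 2.45753641416547965625 - 0.000414105049375 * (y - 1.68275)"
      using y by (simp add: algebra_simps)
    finally show ?thesis .
  qed
  ultimately show ?thesis by linarith
qed

text \<open>\<open>0.6828\<close> is a short decimal next to the minimum point; its value is low
  enough to yield a double point of modulus below \<open>1.1617\<close>.\<close>

lemma dirichlet_poly_upper: "dirichlet_poly 0.6828 < - (11 / 1.1617 ^ 10)"
  by (simp add: dirichlet_poly_def eval_nat_numeral)

section \<open>Immersion and embeddedness\<close>

lemma vector_3_axis: "(vector [a, b, c] :: real^3) = a *\<^sub>R axis 1 1 + b *\<^sub>R axis 2 1 + c *\<^sub>R axis 3 1"
  by (simp add: vec_eq_iff forall_3 axis_def)

lemma has_derivative_vector_3:
  assumes "(f has_derivative f') F" "(g has_derivative g') F" "(h has_derivative h') F"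
  shows "((\<lambda>x. vector [f x, g x, h x] :: real^3) has_derivative (\<lambda>x. vector [f' x, g' x, h' x])) F"
  unfolding vector_3_axis by (intro derivative_intros assms)

text \<open>The Weierstrass representation with Gauss map \<open>z ^ n\<close>: the real parts of
  the integrals of \<open>(1 - z ^ (2 * n)) / 2\<close>, \<open>\<i> * (1 + z ^ (2 * n)) / 2\<close>
  and \<open>z ^ n\<close>.\<close>

definition enneper_map :: "nat \<Rightarrow> complex \<Rightarrow> real^3" where
  "enneper_map n z = vector [Re (z - z ^ (2 * n + 1) / of_nat (2 * n + 1)) / 2,
     - Im (z + z ^ (2 * n + 1) / of_nat (2 * n + 1)) / 2, Re (z ^ (n + 1)) / real (n + 1)]"

lemma enneper_polar: "enneper n u v = enneper_map n (of_real u * cis v)"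
proof -
  define N where "N = 2 * n + 1"
  have N: "real N \<noteq> 0" by (simp add: N_def)
  have "Re (z / of_nat N) = Re z / real N" "Im (z / of_nat N) = Im z / real N" for z
    by (simp_all only: Re_divide_of_nat Im_divide_of_nat)
  moreover define M where "M = n + 1"
  ultimately show ?thesis unfolding enneper_def enneper_map_def Let_def N_def[symmetric] M_def[symmetric]
    using N by (simp add: vec_eq_iff forall_3 power_mult_distrib Complex.DeMoivre field_simps flip: of_real_power)
qed

lemma on_disc_enneper: "on_disc (enneper n) p = enneper_map n (Complex (fst p) (snd p))"
proof -
  have "of_real (cmod z) * cis (Arg2pi z) = z" for z
    by (simp add: complex_eq_iff cos_Arg2pi sin_Arg2pi)
  then show ?thesis
    by (cases p) (simp add: on_disc_def enneper_polar flip: complex_norm)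
qed

text \<open>The first two coordinates, read as one complex number, are half of
  \<open>cnj z - z ^ (2 * n + 1) / (2 * n + 1)\<close>.\<close>

lemma enneper_map_eq_iff:
  "enneper_map n z = enneper_map n w \<longleftrightarrow>
    of_nat (2 * n + 1) * (z - w) = cnj (z ^ (2 * n + 1) - w ^ (2 * n + 1)) \<and>
    Re (z ^ (n + 1)) = Re (w ^ (n + 1))"
proof -
  define N where "N = 2 * n + 1"
  have N: "real N \<noteq> 0" by (simp add: N_def)
  have "Re (z / of_nat N) = Re z / real N" "Im (z / of_nat N) = Im z / real N" for z
    by (simp_all only: Re_divide_of_nat Im_divide_of_nat)
  moreover define M where "M = n + 1"
  then have "real M \<noteq> 0" by simp
  ultimately show ?thesis unfolding enneper_map_def N_def[symmetric] M_def[symmetric] using N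
    by (auto simp: vec_eq_iff forall_3 complex_eq_iff field_simps simp del: complex_cnj_power complex_cnj_diff)
qed

lemma enneper_map_has_derivative:
  "(enneper_map n has_derivative
     (\<lambda>d. vector [Re ((1 - z ^ (2 * n)) * d) / 2, - Im ((1 + z ^ (2 * n)) * d) / 2, Re (z ^ n * d)])) (at z)"
proof -
  define P where "P = (\<lambda>m z. z ^ (m + 1) / complex_of_nat (m + 1))"
  have P: "(P m has_derivative (\<lambda>d. z ^ m * d)) (at z)" for m
  proof -
    have "(P m has_field_derivative z ^ m) (at z)"
      using DERIV_cdivide[OF DERIV_power[OF DERIV_ident, of "m + 1"], of "of_nat (m + 1)"]
      by (simp add: P_def del: of_nat_Suc power_Suc)
    then show ?thesis by (simp add: has_field_derivative_def)
  qed
  have eq: "enneper_map n = (\<lambda>z. vector [Re (z - P (2 * n) z) / 2, - Im (z + P (2 * n) z) / 2, Re (P n z)])"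
    unfolding enneper_map_def P_def by (simp only: Re_divide_of_nat)
  have "(enneper_map n has_derivative (\<lambda>d. vector [Re (d - z ^ (2 * n) * d) / 2,
      - Im (d + z ^ (2 * n) * d) / 2, Re (z ^ n * d)])) (at z)"
    unfolding eq
    by (rule has_derivative_vector_3; (rule P has_derivative_Re)?) (auto intro!: derivative_eq_intros P)
  then show ?thesis by (simp only: left_diff_distrib distrib_right mult_1)
qed

text \<open>If the differential at \<open>z\<close> kills \<open>d\<close>, its first two components
  give \<open>cnj d = z ^ (2 * n) * d\<close>, so \<open>q = z ^ n * d\<close> has square
  \<open>(norm d)\<^sup>2\<close>. The third component makes \<open>q\<close> imaginary, so this
  square is also at most \<open>0\<close>.\<close>

lemma enneper_immersion:
  "\<exists>X'. (on_disc (enneper n) has_derivative X') (at p) \<and> inj X'"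
proof -
  define z where "z = Complex (fst p) (snd p)"
  define L where "L = (\<lambda>d. vector [Re ((1 - z ^ (2 * n)) * d) / 2, - Im ((1 + z ^ (2 * n)) * d) / 2, Re (z ^ n * d)] :: real^3)"
  have C: "((\<lambda>p. Complex (fst p) (snd p)) has_derivative (\<lambda>p. Complex (fst p) (snd p))) (at p)"
    unfolding Complex_eq by (auto intro!: derivative_eq_intros)
  have der: "(on_disc (enneper n) has_derivative (\<lambda>d. L (Complex (fst d) (snd d)))) (at p)"
    unfolding L_def z_def on_disc_enneper[abs_def]
    by (rule has_derivative_compose[OF C enneper_map_has_derivative])
  have "d = 0" if "L d = 0" for d
  proof -
    define q where "q = z ^ n * d"
    have sq: "z ^ (2 * n) = (z ^ n)\<^sup>2" by (metis power_mult mult.commute)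
    have eqs: "Re ((1 - z ^ (2 * n)) * d) = 0" "Im ((1 + z ^ (2 * n)) * d) = 0" "Re q = 0"
      using that by (auto simp: L_def q_def vec_eq_iff forall_3)
    have "cnj d = z ^ (2 * n) * d"
      using eqs(1,2) by (auto simp: complex_eq_iff algebra_simps)
    then have "q\<^sup>2 = d * cnj d"
      unfolding q_def sq by (simp add: power2_eq_square mult_ac)
    then have "Re (q\<^sup>2) = (norm d)\<^sup>2"
      by (simp flip: complex_norm_square)
    moreover have "Re (q\<^sup>2) \<le> 0"
      using eqs(3) by (simp add: power2_eq_square)
    ultimately show ?thesis by simp
  qed
  moreover have "linear (\<lambda>d. L (Complex (fst d) (snd d)))"
    using der has_derivative_linear by blast
  ultimately have "inj (\<lambda>d. L (Complex (fst d) (snd d)))"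
    by (subst linear_injective_0) (fastforce simp: prod_eq_iff complex_eq_iff)+
  with der show ?thesis by blast
qed

section \<open>The moduli of double points and the maximal radius\<close>

definition double_point_radii :: "nat \<Rightarrow> real set" where
  "double_point_radii n =
     {r. r > 0 \<and> (\<exists>\<theta>. sin \<theta> \<noteq> 0 \<and> r ^ (2 * n) * sin (real (2 * n + 1) * \<theta>) = - real (2 * n + 1) * sin \<theta>)}"

lemma enneper_map_double_point:
  assumes "n > 0" "z \<noteq> w" "enneper_map n z = enneper_map n w"
  shows "norm z = norm w" "norm z \<in> double_point_radii n"
proof -
  note eqs = assms(3)[unfolded enneper_map_eq_iff]
  note nz = double_point_norm_eq[OF assms(1,2) eqs[THEN conjunct1] eqs[THEN conjunct2]]
  show "norm z = norm w" by (rule nz(1))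
  show "norm z \<in> double_point_radii n"
    using double_point_polar[OF assms(1,2) eqs[THEN conjunct1] eqs[THEN conjunct2]] nz(2)
    unfolding double_point_radii_def by (metis (mono_tags, lifting) mem_Collect_eq zero_less_norm_iff)
qed

text \<open>The witnesses are \<open>r * cis \<theta>\<close> and its conjugate. Conjugation
  preserves the real part of every power, so the heights agree automatically, and the planar
  equation reduces to the one defining \<open>r\<close>.\<close>

lemma enneper_map_double_point_exists:
  assumes "r \<in> double_point_radii n"
  obtains z w where "norm z = r" "norm w = r" "z \<noteq> w" "enneper_map n z = enneper_map n w"
proof -
  define N where "N = 2 * n + 1"
  obtain \<theta> :: real where r: "r > 0" and \<theta>: "sin \<theta> \<noteq> 0" "r ^ (2 * n) * sin (N * \<theta>) = - real N * sin \<theta>"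
    using assms unfolding double_point_radii_def mem_Collect_eq N_def by blast
  define z where "z = of_real r * cis \<theta>"
  have pw: "z ^ m = of_real (r ^ m) * cis (m * \<theta>)" for m
    by (simp add: z_def power_mult_distrib Complex.DeMoivre)
  have "r ^ N * sin (N * \<theta>) = - real N * (r * sin \<theta>)"
    using \<theta>(2) by (simp add: N_def mult.assoc)
  then have "of_nat N * (z - cnj z) = cnj (z ^ N - cnj z ^ N)"
    unfolding complex_cnj_power[symmetric] pw by (simp add: complex_eq_iff z_def)
  moreover have "Re (z ^ (n + 1)) = Re (cnj z ^ (n + 1))"
    by (simp only: cnj.sel flip: complex_cnj_power)
  ultimately have "enneper_map n z = enneper_map n (cnj z)"
    unfolding enneper_map_eq_iff N_def by blast
  moreover have "z \<noteq> cnj z" using r \<theta>(1) by (simp add: complex_eq_iff z_def)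
  moreover have "norm z = r" using r by (simp add: z_def norm_mult)
  ultimately show ?thesis using that[of z "cnj z"] by simp
qed

lemma norm_Complex: "norm (Complex (fst p) (snd p)) = norm p"
  by (simp add: complex_norm norm_prod_def)

text \<open>Double points have equal moduli, so the open disc is saturated in the closed one.\<close>

lemma enneper_embedded_le:
  assumes n: "n > 0" and R: "\<And>r. r \<in> double_point_radii n \<Longrightarrow> R \<le> r"
  shows "enneper_embedded n R"
proof -
  let ?f = "on_disc (enneper n)"
  have "isCont ?f p" for p
    using enneper_immersion[of n p] has_derivative_continuous by blast
  then have cont: "continuous_on S ?f" for S
    by (simp add: continuous_at_imp_continuous_on)
  have dp: "norm p = norm q \<and> R \<le> norm p" if "p \<noteq> q" "?f p = ?f q" for p q
  proof -
    have "Complex (fst p) (snd p) \<noteq> Complex (fst q) (snd q)" using that(1) by (simp add: prod_eq_iff)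
    from enneper_map_double_point[OF n this] that(2) R show ?thesis
      unfolding on_disc_enneper norm_Complex by blast
  qed
  have mem: "p \<in> disc R \<longleftrightarrow> norm p < R" for p
    by (simp add: disc_def flip: zero_prod_def)
  have inj: "inj_on ?f (disc R)"
    by (rule inj_onI) (metis dp mem leD)
  \<comment> \<open>On the compact closed disc the map is closed, and a closed map stays closed on
    the full preimage of a set. Saturation identifies the open disc as such a preimage.\<close>
  have "closed_map (top_of_set (cball 0 R)) euclidean ?f"
    using cont by (intro continuous_imp_closed_map) (auto simp: compact_space_subtopology)
  moreover have "{p \<in> topspace (top_of_set (cball 0 R)). ?f p \<in> ?f ` disc R} = disc R" (is "?P = _")
  proof (intro equalityI subsetI)
    fix p assume "p \<in> ?P"
    then obtain q where "q \<in> disc R" "?f p = ?f q" by auto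
    with dp[of p q] show "p \<in> disc R" by (cases "p = q") (auto simp: mem)
  qed (auto simp: mem)
  ultimately have "closed_map (subtopology (top_of_set (cball 0 R)) (disc R)) (top_of_set (?f ` disc R)) ?f"
    by (rule closed_map_restriction)
  moreover have "subtopology (top_of_set (cball 0 R)) (disc R) = top_of_set (disc R)"
    by (simp add: subtopology_subtopology inf.absorb2 disc_def flip: zero_prod_def)
  ultimately have "embedding_map (top_of_set (disc R)) (top_of_set (?f ` disc R)) ?f"
    using inj cont by (intro injective_closed_imp_embedding_map) auto
  then show ?thesis
    unfolding enneper_embedded_def using enneper_immersion by (simp add: embedding_map_in_subtopology)
qed

lemma double_point_radius_not_embedded:
  assumes "r \<in> double_point_radii n" "r < R"
  shows "\<not> enneper_embedded n R"
proof
  assume "enneper_embedded n R"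
  then have inj: "inj_on (on_disc (enneper n)) (disc R)"
    unfolding enneper_embedded_def embedding_map_def
    using homeomorphic_imp_injective_map by fastforce
  obtain z w where zw: "norm z = r" "norm w = r" "z \<noteq> w" "enneper_map n z = enneper_map n w"
    using enneper_map_double_point_exists[OF assms(1)] .
  have "(Re z, Im z) \<in> disc R" "(Re w, Im w) \<in> disc R"
    using zw(1,2) assms(2) by (auto simp: disc_def norm_prod_def cmod_def simp flip: zero_prod_def)
  then have "(Re z, Im z) = (Re w, Im w)"
    by (intro inj_onD[OF inj]) (simp_all add: on_disc_enneper zw(4))
  with zw(3) show False by (simp add: complex_eq_iff)
qed

lemma max_embedded_radius_Inf:
  assumes "n > 0" "double_point_radii n \<noteq> {}" "0 < Inf (double_point_radii n)"
  shows "max_embedded_radius n (Inf (double_point_radii n))"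
proof -
  have "bdd_below (double_point_radii n)"
    by (rule bdd_belowI[of _ 0]) (auto simp: double_point_radii_def)
  then have "enneper_embedded n (Inf (double_point_radii n))"
    using assms(1) by (intro enneper_embedded_le cInf_lower)
  moreover have "R \<le> Inf (double_point_radii n)" if "enneper_embedded n R" for R
    using double_point_radius_not_embedded that assms(2) by (intro cInf_greatest) force+
  ultimately show ?thesis using assms by (simp add: max_embedded_radius_def)
qed

section \<open>The bracket for the radius of order \<open>5\<close>\<close>

lemma double_point_radii_5_lower:
  assumes "r \<in> double_point_radii 5"
  shows "r \<ge> 1.1616"
proof -
  obtain \<theta> :: real where r: "r > 0" and \<theta>: "sin \<theta> \<noteq> 0" "r ^ 10 * sin (11 * \<theta>) = - 11 * sin \<theta>"
    using assms by (auto simp: double_point_radii_def)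
  define k where "k = dirichlet_poly (cos (2 * \<theta>))"
  have "sin \<theta> * (r ^ 10 * k) = r ^ 10 * sin (11 * \<theta>)"
    by (simp add: sin_11 k_def)
  also have "\<dots> = sin \<theta> * - 11"
    using \<theta>(2) by simp
  finally have "sin \<theta> * (r ^ 10 * k) = sin \<theta> * - 11" .
  then have "r ^ 10 * k = - 11"
    using \<theta>(1) by (metis mult_left_cancel)
  moreover have "r ^ 10 * - (11 / 1.1616 ^ 10) \<le> r ^ 10 * k"
    unfolding k_def using r by (intro mult_left_mono dirichlet_poly_lower) auto
  ultimately have "1.1616 ^ 10 \<le> r ^ 10" by (simp add: field_simps)
  then show ?thesis using r by (simp add: power_mono_iff)
qed

text \<open>Any angle with a negative kernel value \<open>k\<close> gives a double point with
  \<open>r ^ 10 = - 11 / k\<close>; the angle is chosen with \<open>cos (2 * \<theta>)\<close> next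
  to the minimum point.\<close>

lemma double_point_radii_5_upper: obtains r where "r \<in> double_point_radii 5" "r < 1.1617"
proof -
  define \<theta> where "\<theta> = arccos 0.6828 / 2"
  define k where "k = dirichlet_poly (cos (2 * \<theta>))"
  have c: "cos (2 * \<theta>) = 0.6828" by (simp add: \<theta>_def)
  have s: "sin \<theta> \<noteq> 0"
  proof
    assume "sin \<theta> = 0"
    then have "cos (2 * \<theta>) = 1" by (simp add: cos_double_sin)
    with c show False by simp
  qed
  have k: "k < - (11 / 1.1617 ^ 10)" unfolding k_def c by (rule dirichlet_poly_upper)
  moreover have "0 < 11 / (1.1617::real) ^ 10" by simp
  ultimately have k0: "k < 0" by linarith
  define r where "r = root 10 (- 11 / k)"
  have r10: "r ^ 10 = - 11 / k" and r0: "r > 0" using k0 by (auto simp: r_def divide_simps)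
  have "r ^ 10 < 1.1617 ^ 10"
    using k k0 unfolding r10 by (simp add: field_simps)
  then have "r < 1.1617" by (rule power_less_imp_less_base) simp
  moreover have "r \<in> double_point_radii 5"
    using r0 s k0 by (auto simp: double_point_radii_def sin_11 r10 k_def[symmetric] intro!: exI[of _ \<theta>])
  ultimately show ?thesis using that by blast
qed

section \<open>Fundamental forms\<close>

lemma has_vector_derivative_vector_3:
  assumes "(f has_real_derivative f') F" "(g has_real_derivative g') F" "(h has_real_derivative h') F"
  shows "((\<lambda>x. vector [f x, g x, h x] :: real^3) has_vector_derivative vector [f', g', h']) F"
proof -
  have "x *\<^sub>R (vector [f', g', h'] :: real^3) = vector [f' * x, g' * x, h' * x]" for x
    by (simp add: vec_eq_iff forall_3)
  then show ?thesis
    using has_derivative_vector_3[OF assms[unfolded has_field_derivative_def]]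
    by (simp add: has_vector_derivative_def)
qed

lemma partial_1I: "((\<lambda>s. f s v) has_vector_derivative d) (at u) \<Longrightarrow> partial 1 f u v = d"
  by (simp add: partial_def vector_derivative_at)

lemma partial_2I: "((\<lambda>t. f u t) has_vector_derivative d) (at v) \<Longrightarrow> partial 2 f u v = d"
  by (simp add: partial_def vector_derivative_at)

lemma enneper_partial_1:
  "partial 1 (enneper n) = (\<lambda>u v. vector [(cos v - (u ^ n)\<^sup>2 * cos (real (2 * n + 1) * v)) / 2,
     (- sin v - (u ^ n)\<^sup>2 * sin (real (2 * n + 1) * v)) / 2, u ^ n * cos (real (n + 1) * v)])"
proof (intro ext partial_1I)
  fix u v :: real
  define N M where "N = 2 * n + 1" and "M = n + 1"
  have [simp]: "N \<noteq> 0" "M \<noteq> 0" by (simp_all add: N_def M_def)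
  have [simp]: "u ^ (N - Suc 0) = (u ^ n)\<^sup>2" "u ^ (M - Suc 0) = u ^ n"
    by (simp_all add: N_def M_def mult.commute flip: power_mult)
  show "((\<lambda>u. enneper n u v) has_vector_derivative vector [(cos v - (u ^ n)\<^sup>2 * cos (real (2 * n + 1) * v)) / 2,
     (- sin v - (u ^ n)\<^sup>2 * sin (real (2 * n + 1) * v)) / 2, u ^ n * cos (real (n + 1) * v)]) (at u)"
    unfolding enneper_def Let_def N_def[symmetric] M_def[symmetric]
    by (rule has_vector_derivative_vector_3) (auto intro!: derivative_eq_intros simp: field_simps)
qed

lemma enneper_partial_2:
  "partial 2 (enneper n) = (\<lambda>u v. vector [u * (- sin v + (u ^ n)\<^sup>2 * sin (real (2 * n + 1) * v)) / 2,
     u * (- cos v - (u ^ n)\<^sup>2 * cos (real (2 * n + 1) * v)) / 2, - u * u ^ n * sin (real (n + 1) * v)])"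
proof (intro ext partial_2I)
  fix u v :: real
  define N M where "N = 2 * n + 1" and "M = n + 1"
  have [simp]: "N \<noteq> 0" "M \<noteq> 0" by (simp_all add: N_def M_def)
  have pw: "u ^ N = u * (u ^ n)\<^sup>2" "u ^ M = u * u ^ n"
    by (simp_all add: N_def M_def mult.commute flip: power_mult)
  show "((\<lambda>v. enneper n u v) has_vector_derivative vector [u * (- sin v + (u ^ n)\<^sup>2 * sin (real (2 * n + 1) * v)) / 2,
     u * (- cos v - (u ^ n)\<^sup>2 * cos (real (2 * n + 1) * v)) / 2, - u * u ^ n * sin (real (n + 1) * v)]) (at v)"
    unfolding enneper_def Let_def N_def[symmetric] M_def[symmetric] pw
    by (rule has_vector_derivative_vector_3) (auto intro!: derivative_eq_intros simp: field_simps)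
qed

lemma enneper_partial_11:
  "partial 1 (partial 1 (enneper n)) u v =
     (n * u ^ (n - 1)) *\<^sub>R vector [- (u ^ n * cos (real (2 * n + 1) * v)), - (u ^ n * sin (real (2 * n + 1) * v)), cos (real (n + 1) * v)]"
  (is "_ = ?X")
proof (rule partial_1I)
  have X: "?X = vector [- (n * u ^ (n - 1) * u ^ n * cos (real (2 * n + 1) * v)),
      - (n * u ^ (n - 1) * u ^ n * sin (real (2 * n + 1) * v)), n * u ^ (n - 1) * cos (real (n + 1) * v)]"
    by (simp add: vec_eq_iff forall_3)
  show "((\<lambda>u. partial 1 (enneper n) u v) has_vector_derivative ?X) (at u)"
    unfolding X enneper_partial_1
    by (rule has_vector_derivative_vector_3) (auto intro!: derivative_eq_intros)
qed

lemma enneper_partial_12: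
  "partial 1 (partial 2 (enneper n)) u v =
     vector [(- sin v + real (2 * n + 1) * (u ^ n)\<^sup>2 * sin (real (2 * n + 1) * v)) / 2,
     (- cos v - real (2 * n + 1) * (u ^ n)\<^sup>2 * cos (real (2 * n + 1) * v)) / 2,
     - real (n + 1) * u ^ n * sin (real (n + 1) * v)]"
proof (rule partial_1I)
  define N M where "N = 2 * n + 1" and "M = n + 1"
  have pw: "u ^ (N - Suc 0) = (u ^ n)\<^sup>2" "u ^ (M - Suc 0) = u ^ n" for u :: real
    by (simp_all add: N_def M_def mult.commute flip: power_mult)
  have eq: "partial 2 (enneper n) u v = vector [(u ^ N * sin (real N * v) - u * sin v) / 2,
     (- u * cos v - u ^ N * cos (real N * v)) / 2, - (u ^ M * sin (real M * v))]" for u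
    by (simp add: enneper_partial_2 N_def M_def algebra_simps power_add flip: power_mult)
  show "((\<lambda>u. partial 2 (enneper n) u v) has_vector_derivative
    vector [(- sin v + real (2 * n + 1) * (u ^ n)\<^sup>2 * sin (real (2 * n + 1) * v)) / 2,
     (- cos v - real (2 * n + 1) * (u ^ n)\<^sup>2 * cos (real (2 * n + 1) * v)) / 2,
     - real (n + 1) * u ^ n * sin (real (n + 1) * v)]) (at u)"
    unfolding eq N_def[symmetric] M_def[symmetric]
    by (rule has_vector_derivative_vector_3) (auto intro!: derivative_eq_intros simp: pw)
qed

lemma enneper_partial_21:
  "partial 2 (partial 1 (enneper n)) u v = partial 1 (partial 2 (enneper n)) u v"
  unfolding enneper_partial_12
proof (rule partial_2I)
  define N M where "N = real (2 * n + 1)" and "M = real (n + 1)"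
  show "((\<lambda>v. partial 1 (enneper n) u v) has_vector_derivative
    vector [(- sin v + real (2 * n + 1) * (u ^ n)\<^sup>2 * sin (real (2 * n + 1) * v)) / 2,
     (- cos v - real (2 * n + 1) * (u ^ n)\<^sup>2 * cos (real (2 * n + 1) * v)) / 2,
     - real (n + 1) * u ^ n * sin (real (n + 1) * v)]) (at v)"
    unfolding enneper_partial_1 N_def[symmetric] M_def[symmetric]
    by (rule has_vector_derivative_vector_3) (auto intro!: derivative_eq_intros simp: field_simps)
qed

lemma enneper_partial_22:
  "partial 2 (partial 2 (enneper n)) u v =
     vector [u * (- cos v + real (2 * n + 1) * (u ^ n)\<^sup>2 * cos (real (2 * n + 1) * v)) / 2,
     u * (sin v + real (2 * n + 1) * (u ^ n)\<^sup>2 * sin (real (2 * n + 1) * v)) / 2,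
     - u * u ^ n * real (n + 1) * cos (real (n + 1) * v)]"
proof (rule partial_2I)
  show "((\<lambda>v. partial 2 (enneper n) u v) has_vector_derivative
     vector [u * (- cos v + real (2 * n + 1) * (u ^ n)\<^sup>2 * cos (real (2 * n + 1) * v)) / 2,
     u * (sin v + real (2 * n + 1) * (u ^ n)\<^sup>2 * sin (real (2 * n + 1) * v)) / 2,
     - u * u ^ n * real (n + 1) * cos (real (n + 1) * v)]) (at v)"
    unfolding enneper_partial_2
    by (rule has_vector_derivative_vector_3) (auto intro!: derivative_eq_intros)
qed

lemma inner_vector_3: "(vector [a, b, c] :: real^3) \<bullet> vector [d, e, f] = a * d + b * e + c * f"
  by (simp add: inner_vec_def sum_3)

lemma cross3_vector_3:
  "cross3 (vector [a, b, c]) (vector [d, e, f]) = vector [b * f - c * e, c * d - a * f, a * e - b * d]"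
  by (simp add: cross3_def)

text \<open>All relations come from \<open>v + n v = (n + 1) v\<close> and
  \<open>(n + 1) v + n v = (2 n + 1) v\<close>. They are what remains to be known about the angles
  once sines and cosines are replaced by plain variables.\<close>

lemma enneper_angles:
  fixes n :: nat and v :: real
  defines "a \<equiv> real (n + 1) * v" and "b \<equiv> real n * v" and "c \<equiv> real (2 * n + 1) * v"
  shows "cos a * cos v + sin a * sin v = cos b" "cos a * cos c + sin a * sin c = cos b"
    "sin a * cos v - cos a * sin v = sin b" "cos a * sin c - sin a * cos c = sin b"
    "cos c * cos b + sin c * sin b = cos a" "cos v * cos b - sin v * sin b = cos a"
    "sin v * cos b + cos v * sin b = sin a" "sin c * cos b - cos c * sin b = sin a"
proof -
  have "a - v = b" "c - a = b" "c - b = a" "v + b = a"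
    by (simp_all add: a_def b_def c_def algebra_simps)
  note ab = this
  show "cos a * cos v + sin a * sin v = cos b" using cos_diff[of a v] ab(1) by simp
  show "cos a * cos c + sin a * sin c = cos b" using cos_diff[of c a] ab(2) by (simp add: mult.commute)
  show "sin a * cos v - cos a * sin v = sin b" using sin_diff[of a v] ab(1) by simp
  show "cos a * sin c - sin a * cos c = sin b" using sin_diff[of c a] ab(2) by (simp add: mult.commute)
  show "cos c * cos b + sin c * sin b = cos a" using cos_diff[of c b] ab(3) by simp
  show "cos v * cos b - sin v * sin b = cos a" using cos_add[of v b] ab(4) by simp
  show "sin v * cos b + cos v * sin b = sin a" using sin_add[of v b] ab(4) by simp
  show "sin c * cos b - cos c * sin b = sin a" using sin_diff[of c b] ab(3) by simp
qed

lemma enneper_cross: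
  "cross3 (partial 1 (enneper n) u v) (partial 2 (enneper n) u v) =
     (u * (1 + (u ^ n)\<^sup>2) / 4) *\<^sub>R vector [2 * u ^ n * cos (real n * v), 2 * u ^ n * sin (real n * v), (u ^ n)\<^sup>2 - 1]"
proof -
  define s where "s = u ^ n"
  define ca sa cb sb cc sc P Q where trig: "ca = cos (real (n + 1) * v)" "sa = sin (real (n + 1) * v)"
    "cb = cos (real n * v)" "sb = sin (real n * v)"
    "cc = cos (real (2 * n + 1) * v)" "sc = sin (real (2 * n + 1) * v)" "P = cos v" "Q = sin v"
  note eqs = enneper_angles[where n = n and v = v, folded trig]
  have PQ: "P\<^sup>2 + Q\<^sup>2 = 1" "cc\<^sup>2 + sc\<^sup>2 = 1"
    by (simp_all add: trig)
  have C1: "(- Q - s\<^sup>2 * sc) / 2 * (- u * s * sa) - s * ca * (u * (- P - s\<^sup>2 * cc) / 2)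
      = u * s / 2 * ((ca * P + sa * Q) + s\<^sup>2 * (ca * cc + sa * sc))"
    by (simp add: field_simps)
  have C2: "s * ca * (u * (- Q + s\<^sup>2 * sc) / 2) - (P - s\<^sup>2 * cc) / 2 * (- u * s * sa)
      = u * s / 2 * ((sa * P - ca * Q) + s\<^sup>2 * (ca * sc - sa * cc))"
    by (simp add: field_simps)
  have C3: "(P - s\<^sup>2 * cc) / 2 * (u * (- P - s\<^sup>2 * cc) / 2) - (- Q - s\<^sup>2 * sc) / 2 * (u * (- Q + s\<^sup>2 * sc) / 2)
      = u / 4 * (s\<^sup>2 * s\<^sup>2 * (cc\<^sup>2 + sc\<^sup>2) - (P\<^sup>2 + Q\<^sup>2))"
    by (simp add: power2_eq_square field_simps)
  show ?thesis
    unfolding enneper_partial_1 enneper_partial_2 trig[symmetric] s_def[symmetric] cross3_vector_3 C1 C2 C3 eqs PQ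
    by (simp add: vec_eq_iff forall_3 field_simps power2_eq_square)
qed

lemma enneper_normal_norm:
  "norm (vector [2 * s * cos b, 2 * s * sin b, s\<^sup>2 - 1] :: real^3) = 1 + s\<^sup>2"
proof -
  have "(2 * s * cos b) * (2 * s * cos b) + (2 * s * sin b) * (2 * s * sin b) + (s\<^sup>2 - 1) * (s\<^sup>2 - 1)
     = 4 * s\<^sup>2 * ((cos b)\<^sup>2 + (sin b)\<^sup>2) + (s\<^sup>2 - 1)\<^sup>2"
    by algebra
  also have "\<dots> = (1 + s\<^sup>2)\<^sup>2"
    by (simp add: power2_eq_square algebra_simps)
  finally show ?thesis
    by (simp add: norm_eq_sqrt_inner inner_vector_3)
qed

text \<open>The normal is the inverse stereographic projection of the Gauss map
  \<open>z ^ n\<close>.\<close>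

lemma enneper_unit_normal:
  assumes "u > 0"
  shows "unit_normal (enneper n) u v =
    inverse (1 + (u ^ n)\<^sup>2) *\<^sub>R vector [2 * u ^ n * cos (real n * v), 2 * u ^ n * sin (real n * v), (u ^ n)\<^sup>2 - 1]"
proof -
  have "u * (1 + (u ^ n)\<^sup>2) / 4 > 0"
    using assms by (simp add: add_pos_nonneg)
  then show ?thesis
    unfolding unit_normal_def enneper_cross
    by (simp add: sgn_scaleR) (simp add: sgn_div_norm enneper_normal_norm)
qed

text \<open>The coordinate \<open>z\<close> is conformal; the factor \<open>u\<^sup>2\<close> is
  that of the flat metric in polar coordinates. The mixed trigonometric terms cancel because
  \<open>2 * (n + 1) * v\<close> is \<open>v\<close> plus \<open>(2 * n + 1) * v\<close>.\<close>

lemma enneper_metric: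
  "metric (enneper n) u v =
    (\<chi> i j. if i = j then ((1 + (u ^ n)\<^sup>2) / 2)\<^sup>2 * (if i = 1 then 1 else u\<^sup>2) else 0)"
proof -
  define s where "s = u ^ n"
  define ca sa cc sc P Q where trig: "ca = cos (real (n + 1) * v)" "sa = sin (real (n + 1) * v)"
    "cc = cos (real (2 * n + 1) * v)" "sc = sin (real (2 * n + 1) * v)" "P = cos v" "Q = sin v"
  have "2 * (real (n + 1) * v) = v + real (2 * n + 1) * v"
    by (simp add: algebra_simps)
  then have "cos (2 * (real (n + 1) * v)) = P * cc - Q * sc" "sin (2 * (real (n + 1) * v)) = Q * cc + P * sc"
    unfolding trig by (simp_all only: cos_add sin_add)
  then have ca: "ca * ca = (1 + (P * cc - Q * sc)) / 2" "sa * sa = (1 - (P * cc - Q * sc)) / 2" "ca * sa = (Q * cc + P * sc) / 2"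
    using cos_double_cos[of "real (n + 1) * v"] cos_double_sin[of "real (n + 1) * v"] sin_double[of "real (n + 1) * v"]
    unfolding trig[symmetric] power2_eq_square by (auto simp: mult.commute)
  have PQ: "P * P = 1 - Q * Q" "cc * cc = 1 - sc * sc"
    by (simp_all add: trig cos_squared_eq flip: power2_eq_square)
  have "(P - s\<^sup>2 * cc) / 2 * ((P - s\<^sup>2 * cc) / 2) + (- Q - s\<^sup>2 * sc) / 2 * ((- Q - s\<^sup>2 * sc) / 2) + s * ca * (s * ca)
      = (P * P + Q * Q + (s\<^sup>2)\<^sup>2 * (cc * cc + sc * sc)) / 4 - s\<^sup>2 * (P * cc - Q * sc) / 2 + s\<^sup>2 * (ca * ca)"
    by (simp add: power2_eq_square field_simps)
  also have "\<dots> = ((1 + s\<^sup>2) / 2)\<^sup>2"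
    unfolding ca PQ by (simp add: power2_eq_square field_simps)
  finally have 11: "(P - s\<^sup>2 * cc) / 2 * ((P - s\<^sup>2 * cc) / 2) + (- Q - s\<^sup>2 * sc) / 2 * ((- Q - s\<^sup>2 * sc) / 2) + s * ca * (s * ca)
      = ((1 + s\<^sup>2) / 2)\<^sup>2" .
  have "(P - s\<^sup>2 * cc) / 2 * (u * (- Q + s\<^sup>2 * sc) / 2) + (- Q - s\<^sup>2 * sc) / 2 * (u * (- P - s\<^sup>2 * cc) / 2) + s * ca * (- u * s * sa)
      = u * s\<^sup>2 * ((Q * cc + P * sc) / 2 - ca * sa)"
    by (simp add: power2_eq_square field_simps)
  then have 12: "(P - s\<^sup>2 * cc) / 2 * (u * (- Q + s\<^sup>2 * sc) / 2) + (- Q - s\<^sup>2 * sc) / 2 * (u * (- P - s\<^sup>2 * cc) / 2) + s * ca * (- u * s * sa) = 0"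
    unfolding ca by simp
  have "u * (- Q + s\<^sup>2 * sc) / 2 * (u * (- Q + s\<^sup>2 * sc) / 2) + u * (- P - s\<^sup>2 * cc) / 2 * (u * (- P - s\<^sup>2 * cc) / 2) + - u * s * sa * (- u * s * sa)
      = u\<^sup>2 * ((P * P + Q * Q + (s\<^sup>2)\<^sup>2 * (cc * cc + sc * sc)) / 4 + s\<^sup>2 * (P * cc - Q * sc) / 2 + s\<^sup>2 * (sa * sa))"
    by (simp add: power2_eq_square field_simps)
  also have "\<dots> = ((1 + s\<^sup>2) / 2)\<^sup>2 * u\<^sup>2"
    unfolding ca PQ by (simp add: power2_eq_square field_simps)
  finally have 22: "u * (- Q + s\<^sup>2 * sc) / 2 * (u * (- Q + s\<^sup>2 * sc) / 2) + u * (- P - s\<^sup>2 * cc) / 2 * (u * (- P - s\<^sup>2 * cc) / 2) + - u * s * sa * (- u * s * sa)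
      = ((1 + s\<^sup>2) / 2)\<^sup>2 * u\<^sup>2" .
  have "partial 1 (enneper n) u v \<bullet> partial 1 (enneper n) u v = ((1 + s\<^sup>2) / 2)\<^sup>2"
    "partial 1 (enneper n) u v \<bullet> partial 2 (enneper n) u v = 0"
    "partial 2 (enneper n) u v \<bullet> partial 2 (enneper n) u v = ((1 + s\<^sup>2) / 2)\<^sup>2 * u\<^sup>2"
    unfolding enneper_partial_1 enneper_partial_2 trig[symmetric] s_def[symmetric] inner_vector_3
    by (fact 11 12 22)+
  then show ?thesis
    by (simp add: metric_def vec_eq_iff forall_2 inner_commute s_def)
qed

text \<open>This is the classical curvature of a minimal surface in terms of its Gauss map
  \<open>g = z ^ n\<close>, with the modulus of \<open>g'\<close> written as
  \<open>n * u ^ n / u\<close>. The entries of the second form carry the cosine and sine of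
  \<open>(n + 1) * v\<close>, whose squares add up in the determinant.\<close>

lemma enneper_curvature:
  assumes "u > 0"
  shows "gauss_curvature (enneper n) u v = - (4 * real n * u ^ n / (u * (1 + (u ^ n)\<^sup>2)\<^sup>2))\<^sup>2"
proof -
  define s where "s = u ^ n"
  define d where "d = real n * u ^ (n - 1)"
  \<comment> \<open>For \<open>n = 0\<close> the exponent \<open>n - 1\<close> is truncated, but
    then both sides are \<open>0\<close>; hence the case split.\<close>
  have ud: "u * d = n * s" by (cases n) (auto simp: d_def s_def)
  define ca sa cb sb cc sc P Q where trig: "ca = cos (real (n + 1) * v)" "sa = sin (real (n + 1) * v)"
    "cb = cos (real n * v)" "sb = sin (real n * v)"
    "cc = cos (real (2 * n + 1) * v)" "sc = sin (real (2 * n + 1) * v)" "P = cos v" "Q = sin v"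
  note eqs = enneper_angles[where n = n and v = v, folded trig]
  define w :: "real^3" where "w = vector [2 * s * cb, 2 * s * sb, s\<^sup>2 - 1]"
  have 11: "partial 1 (partial 1 (enneper n)) u v \<bullet> w = - d * ca * (1 + s\<^sup>2)"
  proof -
    have "d * (- (s * cc)) * (2 * s * cb) + d * (- (s * sc)) * (2 * s * sb) + d * ca * (s\<^sup>2 - 1)
      = - 2 * d * s\<^sup>2 * (cc * cb + sc * sb) + d * ca * (s\<^sup>2 - 1)"
      by (simp add: power2_eq_square algebra_simps)
    then show ?thesis
      unfolding enneper_partial_11 w_def trig[symmetric] s_def[symmetric] d_def[symmetric] eqs
      by (simp add: inner_vector_3 algebra_simps)
  qed
  have 12: "partial 1 (partial 2 (enneper n)) u v \<bullet> w = n * s * sa * (1 + s\<^sup>2)"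
  proof -
    have "(- Q + m * s\<^sup>2 * sc) / 2 * (2 * s * cb) + (- P - m * s\<^sup>2 * cc) / 2 * (2 * s * sb)
       = - s * (Q * cb + P * sb) + m * s * s\<^sup>2 * (sc * cb - cc * sb)" for m
      by (simp add: field_simps)
    note eq = this
    show ?thesis
      unfolding enneper_partial_12 w_def trig[symmetric] s_def[symmetric] inner_vector_3 eq eqs
      by (simp add: algebra_simps)
  qed
  have 22: "partial 2 (partial 2 (enneper n)) u v \<bullet> w = u * n * s * ca * (1 + s\<^sup>2)"
  proof -
    have "u * (- P + m * s\<^sup>2 * cc) / 2 * (2 * s * cb) + u * (Q + m * s\<^sup>2 * sc) / 2 * (2 * s * sb)
       = - u * s * (P * cb - Q * sb) + u * m * s * s\<^sup>2 * (cc * cb + sc * sb)" for m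
      by (simp add: field_simps)
    note eq = this
    show ?thesis
      unfolding enneper_partial_22 w_def trig[symmetric] s_def[symmetric] inner_vector_3 eq eqs
      by (simp add: algebra_simps)
  qed
  have pos: "1 + s\<^sup>2 > 0" by (simp add: add_pos_nonneg)
  have N: "unit_normal (enneper n) u v = inverse (1 + s\<^sup>2) *\<^sub>R w"
    unfolding enneper_unit_normal[OF assms] w_def trig s_def ..
  have cancel: "inverse (1 + s\<^sup>2) * (x * (1 + s\<^sup>2)) = x" for x
    using pos by simp
  have "det (second_form (enneper n) u v) = - d * ca * (u * n * s * ca) - (n * s * sa)\<^sup>2"
    unfolding det_2 by (simp add: second_form_def N enneper_partial_21 11 12 22 cancel) (simp add: power2_eq_square)
  also have "\<dots> = - (n * s)\<^sup>2 * (ca\<^sup>2 + sa\<^sup>2)"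
    using ud by (simp add: power2_eq_square algebra_simps)
  also have "\<dots> = - (n * s)\<^sup>2" by (simp add: trig)
  finally have II: "det (second_form (enneper n) u v) = - (n * s)\<^sup>2" .
  have I: "det (metric (enneper n) u v) = (u * ((1 + s\<^sup>2) / 2)\<^sup>2)\<^sup>2"
    by (simp add: enneper_metric det_2 s_def power2_eq_square)
  show ?thesis
    unfolding gauss_curvature_def I II s_def[symmetric] by (simp add: power2_eq_square)
qed

section \<open>The second variation in polar coordinates\<close>

text \<open>The conformal factor cancels between the inverse metric and the area density, which
  leaves the flat polar Dirichlet integrand; the surface survives in the curvature term only.
  \<open>F\<close> is a parameter so that an integrand without a singularity at \<open>u = 0\<close>
  can be supplied.\<close>

lemma second_variation_enneper:
  assumes D: "open D" "D \<subseteq> {0<..} \<times> UNIV"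
    and F: "\<And>u v. (u, v) \<in> D \<Longrightarrow>
      F u v = u * (partial 1 \<phi> u v)\<^sup>2 + (partial 2 \<phi> u v)\<^sup>2 / u
        - 8 * (real n)\<^sup>2 * (u ^ n)\<^sup>2 / (u * (1 + (u ^ n)\<^sup>2)\<^sup>2) * (\<phi> u v)\<^sup>2"
  shows "second_variation (enneper n) D \<phi> = (LINT (u, v):D|lborel. F u v)"
  unfolding second_variation_def
proof (rule set_lebesgue_integral_cong, use D(1) in simp, clarify)
  fix u v assume uv: "(u, v) \<in> D"
  then have u: "u > 0" using D by auto
  define L where "L = (1 + (u ^ n)\<^sup>2) / 2"
  have l: "L > 0" by (simp add: L_def add_pos_nonneg)
  define g where "g = metric (enneper n) u v"
  have g: "g = (\<chi> i j. if i = j then L\<^sup>2 * (if i = 1 then 1 else u\<^sup>2) else 0)"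
    unfolding g_def enneper_metric L_def ..
  define h :: "real^2^2" where "h = (\<chi> i j. if i = j then inverse (L\<^sup>2 * (if i = 1 then 1 else u\<^sup>2)) else 0)"
  have gh: "g ** h = mat 1" and hg: "h ** g = mat 1"
    using l u by (simp_all add: g h_def vec_eq_iff forall_2 matrix_matrix_mult_def mat_def sum_2 field_simps)
  \<comment> \<open>\<open>matrix_inv\<close> is defined by choice, so the explicit two-sided
    inverse is identified through uniqueness.\<close>
  have "matrix_inv g = h"
    unfolding matrix_inv_def
  proof (rule some_equality)
    show "x = h" if "g ** x = mat 1 \<and> x ** g = mat 1" for x
      using gh that by (metis matrix_mul_assoc matrix_mul_lid matrix_mul_rid)
  qed (use gh hg in blast)
  moreover have det: "sqrt (det g) = L\<^sup>2 * u"
    using u by (simp add: g det_2 real_sqrt_mult power2_eq_square)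
  ultimately have gradient: "(\<Sum>i\<in>UNIV. \<Sum>j\<in>UNIV. matrix_inv g $ i $ j * partial i \<phi> u v * partial j \<phi> u v) * sqrt (det g)
      = u * (partial 1 \<phi> u v)\<^sup>2 + (partial 2 \<phi> u v)\<^sup>2 / u"
    using u l by (simp add: h_def sum_2 power2_eq_square field_simps)
  have "1 + (u ^ n)\<^sup>2 = 2 * L"
    by (simp add: L_def)
  then have curvature: "gauss_curvature (enneper n) u v * sqrt (det g) = - 4 * (real n)\<^sup>2 * (u ^ n)\<^sup>2 / (u * (1 + (u ^ n)\<^sup>2)\<^sup>2)"
    using u l unfolding enneper_curvature[OF u] det by (simp add: power2_eq_square field_simps)
  have "(S + 2 * k * q) * d = S * d + 2 * (k * d) * q" for S k q d :: real
    by (simp add: algebra_simps)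
  then show "((\<Sum>i\<in>UNIV. \<Sum>j\<in>UNIV. matrix_inv (metric (enneper n) u v) $ i $ j * partial i \<phi> u v * partial j \<phi> u v)
      + 2 * gauss_curvature (enneper n) u v * (\<phi> u v)\<^sup>2) * sqrt (det (metric (enneper n) u v)) = F u v"
    unfolding g_def[symmetric] F[OF uv] by (simp only: gradient curvature)
qed

text \<open>The boundary is a null set, and continuity on the closed rectangle gives both
  integrability and Fubini. The result is an iterated integral to which the fundamental theorem
  applies.\<close>

lemma set_lebesgue_integral_rectangle:
  fixes F :: "real \<Rightarrow> real \<Rightarrow> real"
  assumes "continuous_on ({a..b} \<times> {c..d}) (\<lambda>(u, v). F u v)"
  shows "(LINT (u, v):{a<..<b} \<times> {c<..<d}|lborel. F u v) = integral {a..b} (\<lambda>u. integral {c..d} (F u))"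
proof -
  let ?F = "\<lambda>(u, v). F u v"
  have box: "{a<..<b} \<times> {c<..<d} = box (a, c) (b, d)" and cbox: "{a..b} \<times> {c..d} = cbox (a, c) (b, d)"
    by (auto simp: box_def cbox_def Basis_prod_def)
  have "set_integrable lborel (cbox (a, c) (b, d)) ?F"
    unfolding set_integrable_def using assms unfolding cbox
    by (intro borel_integrable_compact) auto
  then have "set_integrable lborel (box (a, c) (b, d)) ?F"
    by (rule set_integrable_subset) (simp_all add: box_subset_cbox)
  then have "(LINT p:box (a, c) (b, d)|lborel. ?F p) = integral (cbox (a, c) (b, d)) ?F"
    using set_borel_integral_eq_integral(2) integral_open_interval by metis
  also have "\<dots> = integral {a..b} (\<lambda>u. integral {c..d} (F u))"
    using integral_prod_continuous[of a c b d ?F] assms unfolding cbox by simp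
  finally show ?thesis unfolding box .
qed

text \<open>\<open>weight 0\<close> is \<open>- 2 \<kappa> \<surd>|g|\<close> for order \<open>5\<close>, and \<open>weight k\<close> its product with \<open>u\<^sup>2\<^sup>k\<close>.\<close>

definition weight :: "nat \<Rightarrow> real \<Rightarrow> real" where
  "weight k u = 200 * u ^ (9 + 2 * k) / (1 + u ^ 10)\<^sup>2"

lemma weight_0:
  assumes "u > 0"
  shows "8 * (real 5)\<^sup>2 * (u ^ 5)\<^sup>2 / (u * (1 + (u ^ 5)\<^sup>2)\<^sup>2) = weight 0 u"
proof -
  have u10: "(u ^ 5)\<^sup>2 = u ^ 10" by (simp flip: power_mult)
  have "8 * (real 5)\<^sup>2 * u ^ 10 = u * (200 * u ^ 9)"
    by (simp add: eval_nat_numeral)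
  with assms show ?thesis unfolding u10 weight_def by simp
qed

lemma weight_shift: "weight k u = weight 0 u * u ^ (2 * k)"
  by (simp add: weight_def power_add)

lemma one_plus_power_pos: "1 + (u::real) ^ 10 > 0"
  by (simp add: add_pos_nonneg)

lemma continuous_on_weight [continuous_intros]: "continuous_on S (weight k)"
  unfolding weight_def using one_plus_power_pos by (intro continuous_intros) (metis less_irrefl zero_less_power)

text \<open>\<open>- 20 / (1 + u\<^sup>1\<^sup>0)\<close> is a primitive of \<open>weight 0\<close>; the factor \<open>u\<^sup>2\<^sup>k\<close> is bounded below by \<open>0\<close>,
  \<open>0.85\<^sup>2\<^sup>k\<close> and \<open>1\<close> on the three pieces cut off at \<open>0.85\<close> and \<open>1\<close>.\<close>

lemma weight_integral_lower:
  assumes R: "1.1616 \<le> R"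
  shows "integral {0..R} (weight k) \<ge> 20 * (0.85 ^ (2 * k) * (1 / (1 + 0.85 ^ 10) - 1 / 2) + (1 / 2 - 1 / (1 + 1.1616 ^ 10)))"
proof -
  have cont: "weight k integrable_on {a..b}" for a b
    by (intro integrable_continuous_interval continuous_intros)
  have low: "integral {a..b} (weight k) \<ge> 20 * a ^ (2 * k) * (1 / (1 + a ^ 10) - 1 / (1 + b ^ 10))" if ab: "0 \<le> a" "a \<le> b" for a b
  proof -
    have "(weight 0 has_integral - 20 / (1 + b ^ 10) - - 20 / (1 + a ^ 10)) {a..b}"
    proof (rule fundamental_theorem_of_calculus[OF ab(2)])
      fix u
      show "((\<lambda>u. - 20 / (1 + u ^ 10)) has_vector_derivative weight 0 u) (at u within {a..b})"
        using one_plus_power_pos[of u]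
        by (auto intro!: derivative_eq_intros simp: weight_def power2_eq_square simp flip: has_real_derivative_iff_has_vector_derivative)
    qed
    then have "((\<lambda>u. a ^ (2 * k) * weight 0 u) has_integral a ^ (2 * k) * (20 / (1 + a ^ 10) - 20 / (1 + b ^ 10))) {a..b}"
      by (intro has_integral_mult_right) simp
    moreover have "a ^ (2 * k) * weight 0 u \<le> weight k u" if "u \<in> {a..b}" for u
    proof -
      have "a ^ (2 * k) * (200 * u ^ 9 / (1 + u ^ 10)\<^sup>2) \<le> u ^ (2 * k) * (200 * u ^ 9 / (1 + u ^ 10)\<^sup>2)"
        using that ab by (intro mult_right_mono power_mono) auto
      then show ?thesis by (simp add: weight_def power_add mult_ac)
    qed
    ultimately have "a ^ (2 * k) * (20 / (1 + a ^ 10) - 20 / (1 + b ^ 10)) \<le> integral {a..b} (weight k)"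
      using has_integral_le[OF _ integrable_integral[OF cont]] by blast
    then show ?thesis by (simp add: algebra_simps)
  qed
  have "integral {0..R} (weight k) = integral {0..0.85} (weight k) + integral {0.85..1} (weight k) + integral {1..R} (weight k)"
    using R by (simp add: Henstock_Kurzweil_Integration.integral_combine[OF _ _ cont])
  moreover have "integral {0..0.85} (weight k) \<ge> 0"
    by (rule integral_nonneg[OF cont]) (simp add: weight_def)
  moreover note low[of "0.85" 1] low[of 1 R]
  moreover have "1 / (1 + R ^ 10) \<le> 1 / (1 + 1.1616 ^ 10)"
    using R by (intro divide_left_mono add_left_mono power_mono mult_pos_pos one_plus_power_pos) auto
  ultimately show ?thesis using R by (simp add: algebra_simps)
qed

section \<open>The test function on a slice\<close>

text \<open>For \<open>a = 4.24\<close> and \<open>b = 4.15\<close> the support ends at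
  \<open>b - a = - 0.09\<close> and \<open>b + a = 8.39\<close>, which gives the factors of the
  denominator. The normalising constant of \<open>bump\<close> is left out, as it only rescales the
  second variation.\<close>

definition bump_exponent :: "real \<Rightarrow> real" where
  "bump_exponent v = 4.24 / ((v + 0.09) * (8.39 - v))"

lemma bump_exponent_pos: "0 \<le> v \<Longrightarrow> v \<le> 2 \<Longrightarrow> 0 < bump_exponent v"
  by (simp add: bump_exponent_def)

lemma bump_eq:
  assumes "0 \<le> v" "v \<le> 2"
  shows "bump v 4.24 4.15 = exp (- bump_exponent v) / exp (- (1 / 4.24))"
proof -
  have "(4.24::real)\<^sup>2 - (v - 4.15)\<^sup>2 = (v + 0.09) * (8.39 - v)"
    by (simp add: power2_eq_square field_simps)
  moreover have "\<bar>v - 4.15\<bar> < \<bar>4.24\<bar>" using assms by (simp add: abs_less_iff)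
  ultimately show ?thesis by (simp only: bump_def bump_exponent_def if_True)
qed

lemma bump_exponent_deriv:
  assumes "0 \<le> v" "v \<le> 2"
  shows "(bump_exponent has_real_derivative - (4.24 * (8.3 - 2 * v) / ((v + 0.09) * (8.39 - v))\<^sup>2)) (at v)"
proof -
  have "((\<lambda>v. (v + 0.09) * (8.39 - v)) has_real_derivative 8.3 - 2 * v) (at v)"
    by (auto intro!: derivative_eq_intros)
  from DERIV_divide[OF DERIV_const this, of "4.24"] assms show ?thesis
    by (simp add: bump_exponent_def[abs_def] power2_eq_square)
qed

definition bump_slope :: "real \<Rightarrow> real" where
  "bump_slope v = 4.24 * (8.3 - 2 * v) / ((v + 0.09) * (8.39 - v))\<^sup>2 * exp (- bump_exponent v)"

lemma bump_exponent_exp_deriv: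
  assumes "0 \<le> v" "v \<le> 2"
  shows "((\<lambda>v. exp (- bump_exponent v)) has_real_derivative bump_slope v) (at v)"
  using bump_exponent_deriv[OF assms]
  by (auto intro!: derivative_eq_intros simp: bump_slope_def)

text \<open>With \<open>x\<close> the exponent, the slope is \<open>x\<^sup>2 * exp (- x)\<close>
  times \<open>(8.3 - 2 * v) / 4.24\<close>. The first factor is at most \<open>4 / exp 2\<close>,
  its value at \<open>x = 2\<close>, and the second is below \<open>2\<close>.\<close>

lemma bump_slope_bound:
  assumes "0 \<le> v" "v \<le> 2"
  shows "(bump_slope v)\<^sup>2 \<le> 64 / exp 4"
proof -
  define x where "x = bump_exponent v"
  have x: "x > 0" using assms by (simp add: x_def bump_exponent_pos)
  have "1 + (x / 2 - 1) \<le> exp (x / 2 - 1)" by (rule exp_ge_add_one_self)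
  then have "x / 2 \<le> exp (x / 2) / exp 1" unfolding exp_diff by simp
  then have "x * exp 1 \<le> 2 * exp (x / 2)" by (simp add: field_simps)
  then have "(x * exp 1)\<^sup>2 \<le> (2 * exp (x / 2))\<^sup>2" using x by (intro power_mono) auto
  then have *: "x\<^sup>2 * exp (- x) \<le> 4 / exp 2"
    by (simp add: power_mult_distrib exp_minus field_simps flip: exp_double)
  have "bump_slope v = x\<^sup>2 * ((8.3 - 2 * v) / 4.24) * exp (- x)"
  proof -
    have "4.24 * c / W\<^sup>2 = (4.24 / W)\<^sup>2 * (c / 4.24)" for c W :: real
      by (cases "W = 0") (simp_all add: power2_eq_square field_simps)
    then show ?thesis by (simp only: bump_slope_def x_def bump_exponent_def)
  qed
  also have "\<dots> \<le> x\<^sup>2 * 2 * exp (- x)"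
    using assms by (intro mult_right_mono mult_left_mono) auto
  also have "\<dots> \<le> 8 / exp 2" using * by simp
  finally have le: "bump_slope v \<le> 8 / exp 2" .
  have "0 \<le> bump_slope v" using assms by (simp add: bump_slope_def)
  with le have "(bump_slope v)\<^sup>2 \<le> (8 / exp 2)\<^sup>2" by (intro power_mono)
  also have "\<dots> = 64 / exp 4" by (simp add: power_divide flip: exp_double)
  finally show ?thesis .
qed

lemma continuous_on_bump_exponent: "continuous_on {0..2} bump_exponent"
  unfolding bump_exponent_def by (intro continuous_intros) auto

lemma continuous_on_bump_slope: "continuous_on {0..2} bump_slope"
  unfolding bump_slope_def by (intro continuous_intros continuous_on_bump_exponent) auto

lemma pi_third: "1.047 \<le> pi / 3" "pi / 3 \<le> 1.0472"
  using pi_approx by simp_all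

lemma bump_slope_integral: "integral {0..pi / 3} (\<lambda>v. (bump_slope v)\<^sup>2) \<le> 1.2615"
proof -
  have "(2.7 :: real) ^ 4 \<le> exp 1 ^ 4"
    using e_approx_32 by (intro power_mono) (auto simp: abs_if split: if_splits)
  then have e4: "53.1441 \<le> exp (4 :: real)"
    using exp_of_nat_mult[of 4 "1 :: real"] by (simp add: power4_eq_xxxx)
  have "integral {0..pi / 3} (\<lambda>v. (bump_slope v)\<^sup>2) \<le> integral {0..pi / 3} (\<lambda>_. 64 / exp 4)"
    using pi_third
    by (intro integral_le integrable_continuous_interval continuous_intros bump_slope_bound
        continuous_on_subset[OF continuous_on_bump_slope]) auto
  also have "\<dots> = pi / 3 * (64 / exp 4)" by simp
  also have "\<dots> \<le> 1.0472 * (64 / 53.1441)"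
    using pi_third e4 by (intro mult_mono divide_left_mono) auto
  finally show ?thesis by simp
qed

text \<open>The function is small near \<open>0\<close>, so the part up to \<open>0.6\<close> is
  dropped. Beyond it the exponent is at most \<open>0.8\<close>, and \<open>exp (- 1.6)\<close>
  exceeds \<open>0.188\<close>.\<close>

lemma bump_square_integral: "integral {0..pi / 3} (\<lambda>v. (exp (- bump_exponent v))\<^sup>2) \<ge> 0.084"
proof -
  have int: "(\<lambda>v. (exp (- bump_exponent v))\<^sup>2) integrable_on {a..b}" if "0 \<le> a" "b \<le> 2" for a b
    using that by (intro integrable_continuous_interval continuous_intros
        continuous_on_subset[OF continuous_on_bump_exponent]) auto
  have low: "0.188 \<le> (exp (- bump_exponent v))\<^sup>2" if v: "0.6 \<le> v" "v \<le> pi / 3" for v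
  proof -
    have "exp (0.1 :: real) \<le> 1.11" using exp_bound[of "0.1"] by (simp add: power2_eq_square)
    then have "exp (0.1 :: real) ^ 16 \<le> 1.11 ^ 16" by (intro power_mono) auto
    then have "exp (1.6 :: real) \<le> 1.11 ^ 16" by (simp flip: exp_of_nat_mult)
    then have e: "0.188 \<le> exp (- 1.6 :: real)"
      by (simp add: exp_minus field_simps)
    have "0.69 * 7.79 \<le> (v + 0.09) * (8.39 - v)"
    proof -
      have "(v + 0.09) * (8.39 - v) - 0.69 * 7.79 = (v - 0.6) * (7.7 - v)"
        by (simp add: field_simps)
      moreover have "(v - 0.6) * (7.7 - v) \<ge> 0" using v pi_third by (intro mult_nonneg_nonneg) auto
      ultimately show ?thesis by linarith
    qed
    then have "bump_exponent v \<le> 4.24 / (0.69 * 7.79)"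
      unfolding bump_exponent_def by (intro divide_left_mono) auto
    then have "- 1.6 \<le> 2 * - bump_exponent v" by simp
    then have "exp (- 1.6) \<le> exp (2 * - bump_exponent v)" by (rule exp_le_cancel_iff[THEN iffD2])
    with e show ?thesis unfolding exp_double by linarith
  qed
  have "0.188 * (pi / 3 - 0.6) = integral {0.6..pi / 3} (\<lambda>_. 0.188)"
    using pi_third by simp
  also have "\<dots> \<le> integral {0.6..pi / 3} (\<lambda>v. (exp (- bump_exponent v))\<^sup>2)"
    using low pi_third by (intro integral_le int) auto
  also have "\<dots> \<le> integral {0..pi / 3} (\<lambda>v. (exp (- bump_exponent v))\<^sup>2)"
    using pi_third by (intro integral_subset_le int) auto
  finally show ?thesis using pi_third by simp
qed

lemma bump_destabilizes:
  assumes R: "1.1616 \<le> R" "R < 1.1617"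
  shows "second_variation (enneper 5) ({0<..<R} \<times> {0<..<pi / 3}) (\<lambda>u v. u * bump v 4.24 4.15) < 0"
proof -
  define K where "K = 1 / exp (- (1 / 4.24 :: real))"
  have K: "K > 0" by (simp add: K_def)
  define \<psi> where "\<psi> = (\<lambda>v. exp (- bump_exponent v))"
  define A B where "A = integral {0..pi / 3} (\<lambda>v. (\<psi> v)\<^sup>2)" and "B = integral {0..pi / 3} (\<lambda>v. (bump_slope v)\<^sup>2)"
  define F where "F u v = K\<^sup>2 * (u * ((\<psi> v)\<^sup>2 + (bump_slope v)\<^sup>2) - weight 1 u * (\<psi> v)\<^sup>2)" for u v
  have cont: "continuous_on {0..pi / 3} \<psi>" "continuous_on {0..pi / 3} bump_slope"
    unfolding \<psi>_def using pi_third
    by (auto intro!: continuous_intros continuous_on_subset[OF continuous_on_bump_exponent]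
        continuous_on_subset[OF continuous_on_bump_slope])
  have int: "(\<lambda>v. (\<psi> v)\<^sup>2) integrable_on {0..pi / 3}" "(\<lambda>v. (bump_slope v)\<^sup>2) integrable_on {0..pi / 3}"
    by (intro integrable_continuous_interval continuous_intros cont)+
  have "second_variation (enneper 5) ({0<..<R} \<times> {0<..<pi / 3}) (\<lambda>u v. u * bump v 4.24 4.15)
      = (LINT (u, v):{0<..<R} \<times> {0<..<pi / 3}|lborel. F u v)"
  proof (rule second_variation_enneper)
    fix u v assume "(u, v) \<in> {0<..<R} \<times> {0<..<pi / 3}"
    then have u: "u > 0" and v: "0 < v" "v < pi / 3" by auto
    with pi_third have v': "0 < v" "v < 2" by auto
    \<comment> \<open>The closed formula holds on an open interval around every point of the slice,
      so derivatives of \<open>bump\<close> can be read off from it.\<close>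
    have b: "bump v 4.24 4.15 = K * \<psi> v" if "v \<in> {0<..<2}" for v
      using that bump_eq[of v] by (simp add: K_def \<psi>_def)
    have "((\<lambda>v. u * (K * \<psi> v)) has_real_derivative u * (K * bump_slope v)) (at v)"
      unfolding \<psi>_def using v' by (intro DERIV_cmult bump_exponent_exp_deriv) auto
    then have "((\<lambda>v. u * bump v 4.24 4.15) has_real_derivative u * (K * bump_slope v)) (at v)"
      by (rule has_field_derivative_transform_within_open[where S = "{0<..<2}"]) (use v' b in auto)
    then have p2: "partial 2 (\<lambda>u v. u * bump v 4.24 4.15) u v = u * (K * bump_slope v)"
      by (intro partial_2I) (simp add: has_real_derivative_iff_has_vector_derivative)
    have bv: "bump v 4.24 4.15 = K * \<psi> v" using b v' by simp
    have p1: "partial 1 (\<lambda>u v. u * bump v 4.24 4.15) u v = K * \<psi> v"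
      unfolding bv by (rule partial_1I, unfold bv) (auto intro!: derivative_eq_intros
          simp flip: has_real_derivative_iff_has_vector_derivative)
    show "F u v = u * (partial 1 (\<lambda>u v. u * bump v 4.24 4.15) u v)\<^sup>2
      + (partial 2 (\<lambda>u v. u * bump v 4.24 4.15) u v)\<^sup>2 / u
      - 8 * (real 5)\<^sup>2 * (u ^ 5)\<^sup>2 / (u * (1 + (u ^ 5)\<^sup>2)\<^sup>2) * (u * bump v 4.24 4.15)\<^sup>2"
      using u unfolding p1 p2 bv weight_0[OF u]
      by (simp add: F_def weight_shift[of 1, unfolded One_nat_def] power2_eq_square field_simps)
  qed (auto simp: open_Times)
  also have "\<dots> = integral {0..R} (\<lambda>u. integral {0..pi / 3} (F u))"
    unfolding F_def split_beta
    by (intro set_lebesgue_integral_rectangle[unfolded split_beta] continuous_intros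
        continuous_on_compose2[OF continuous_on_weight] continuous_on_compose2[OF cont(1)]
        continuous_on_compose2[OF cont(2)]) auto
  also have "\<dots> = integral {0..R} (\<lambda>u. K\<^sup>2 * (u * (A + B) - weight 1 u * A))"
  proof (rule integral_cong)
    fix u
    have "(F u has_integral K\<^sup>2 * (u * (A + B) - weight 1 u * A)) {0..pi / 3}"
      unfolding F_def A_def B_def
      by (intro has_integral_mult_right has_integral_diff has_integral_add integrable_integral int)
    then show "integral {0..pi / 3} (F u) = K\<^sup>2 * (u * (A + B) - weight 1 u * A)"
      by (rule integral_unique)
  qed
  also have "\<dots> = K\<^sup>2 * (R\<^sup>2 / 2 * (A + B) - integral {0..R} (weight 1) * A)"
  proof (rule integral_unique, intro has_integral_mult_right has_integral_diff has_integral_mult_left)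
    show "((\<lambda>u. u) has_integral R\<^sup>2 / 2) {0..R}"
      using ident_has_integral[of 0 R] R by simp
    show "(weight 1 has_integral integral {0..R} (weight 1)) {0..R}"
      by (intro integrable_integral integrable_continuous_interval continuous_intros)
  qed
  \<comment> \<open>A lower bound for \<open>A\<close> is enough because its net coefficient
    \<open>0.675 - 11.1\<close> is negative. At \<open>A = 0.084\<close> and
    \<open>B = 1.2615\<close> the two sides are about \<open>0.908\<close> and \<open>0.932\<close>,
    so the constants have little slack.\<close>
  also have "\<dots> < 0"
  proof -
    have A: "A \<ge> 0.084" using bump_square_integral by (simp add: A_def \<psi>_def)
    have B: "B \<le> 1.2615" using bump_slope_integral by (simp add: B_def)
    have "R\<^sup>2 \<le> 1.1617\<^sup>2" using R by (intro power_mono) auto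
    then have R2: "R\<^sup>2 / 2 \<le> 0.675" by (simp add: power2_eq_square)
    have "11.1 \<le> integral {0..R} (weight 1)"
      using weight_integral_lower[OF R(1), of 1] by (rule order_trans[rotated]) (simp add: eval_nat_numeral)
    then have "11.1 * A \<le> integral {0..R} (weight 1) * A" using A by (intro mult_right_mono) auto
    moreover have "A + B \<ge> 0" using A by (auto simp: B_def intro!: add_nonneg_nonneg integral_nonneg int)
    then have "R\<^sup>2 / 2 * (A + B) \<le> 0.675 * (A + B)" using R2 by (intro mult_right_mono) auto
    moreover have "0.675 * (A + B) < 11.1 * A" using A B by simp
    ultimately have "R\<^sup>2 / 2 * (A + B) - integral {0..R} (weight 1) * A < 0" by linarith
    then show ?thesis using K by (simp add: mult_pos_neg)
  qed
  finally show ?thesis .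
qed

section \<open>Trigonometric polynomials with polynomial coefficients\<close>

text \<open>The class is closed under both partial derivatives: the coefficients absorb the one in
  \<open>u\<close>, and exchanging \<open>p\<close> and \<open>q\<close> absorbs the one in
  \<open>v\<close>. Smoothness and boundedness of all iterated partials thus follow from continuity
  and boundedness of the class itself.\<close>

definition trig_poly :: "nat \<Rightarrow> (nat \<Rightarrow> real poly) \<Rightarrow> (nat \<Rightarrow> real poly) \<Rightarrow> real \<Rightarrow> real \<Rightarrow> real" where
  "trig_poly N p q u v = (\<Sum>k\<in>{1..N}. poly (p k) u * cos (real k * v) + poly (q k) u * sin (real k * v))"

lemma trig_poly_has_derivative_1:
  "((\<lambda>u. trig_poly N p q u v) has_real_derivative trig_poly N (\<lambda>k. pderiv (p k)) (\<lambda>k. pderiv (q k)) u v) (at u)"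
  unfolding trig_poly_def by (auto intro!: derivative_eq_intros sum.cong)

lemma trig_poly_has_derivative_2:
  "((\<lambda>v. trig_poly N p q u v) has_real_derivative
    trig_poly N (\<lambda>k. smult (real k) (q k)) (\<lambda>k. - smult (real k) (p k)) u v) (at v)"
  unfolding trig_poly_def by (auto intro!: derivative_eq_intros sum.cong simp: algebra_simps)

lemma partials_trig_poly: "\<exists>p' q'. partials is (trig_poly N p q) = trig_poly N p' q'"
proof (induction "is")
  case Nil
  show ?case by auto
next
  case (Cons i "is")
  then obtain p' q' where eq: "partials is (trig_poly N p q) = trig_poly N p' q'" by blast
  have "partial 1 (trig_poly N p' q') = trig_poly N (\<lambda>k. pderiv (p' k)) (\<lambda>k. pderiv (q' k))"
    using trig_poly_has_derivative_1
    by (simp add: fun_eq_iff partial_def has_real_derivative_iff_has_vector_derivative vector_derivative_at)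
  moreover have "partial 2 (trig_poly N p' q') = trig_poly N (\<lambda>k. smult (real k) (q' k)) (\<lambda>k. - smult (real k) (p' k))"
    using trig_poly_has_derivative_2
    by (simp add: fun_eq_iff partial_def has_real_derivative_iff_has_vector_derivative vector_derivative_at)
  moreover have "i = 1 \<or> i = 2" by (rule exhaust_2)
  ultimately show ?case unfolding partials.simps eq by metis
qed

lemma continuous_on_trig_poly: "continuous_on S (\<lambda>(u, v). trig_poly N p q u v)"
  unfolding trig_poly_def split_beta by (intro continuous_intros)

lemma trig_poly_bounded:
  assumes "bounded S"
  shows "bounded ((\<lambda>(u, v). trig_poly N p q u v) ` (S \<times> UNIV))"
proof -
  define b where "b = (\<lambda>u. \<Sum>k\<in>{1..N}. \<bar>poly (p k) u\<bar> + \<bar>poly (q k) u\<bar>)"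
  have "compact (b ` closure S)"
    unfolding b_def using assms
    by (intro compact_continuous_image continuous_intros) (auto simp: compact_closure)
  then have "bounded (b ` closure S)" by (rule compact_imp_bounded)
  then obtain B where "\<forall>y\<in>b ` closure S. norm y \<le> B" unfolding bounded_iff ..
  then have B: "b u \<le> B" if "u \<in> S" for u
    using that closure_subset[of S] by force
  show ?thesis
  proof (rule boundedI, clarify)
    fix u v assume "u \<in> S"
    have "norm (trig_poly N p q u v) \<le> (\<Sum>k\<in>{1..N}. norm (poly (p k) u * cos (real k * v) + poly (q k) u * sin (real k * v)))"
      unfolding trig_poly_def by (rule norm_sum)
    also have "\<dots> \<le> (\<Sum>k\<in>{1..N}. \<bar>poly (p k) u\<bar> + \<bar>poly (q k) u\<bar>)"
    proof (rule sum_mono)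
      fix k
      show "norm (poly (p k) u * cos (real k * v) + poly (q k) u * sin (real k * v)) \<le> \<bar>poly (p k) u\<bar> + \<bar>poly (q k) u\<bar>"
        by (rule order_trans[OF norm_triangle_ineq])
          (auto simp: abs_mult intro!: add_mono mult_left_le)
    qed
    also have "\<dots> \<le> B"
      using B[OF \<open>u \<in> S\<close>] by (simp add: b_def)
    finally show "norm (trig_poly N p q u v) \<le> B" .
  qed
qed

section \<open>Locality of iterated partial derivatives\<close>

lemma open_slices:
  assumes "open U"
  shows "open {s. (s, v) \<in> U}" "open {t. (u, t) \<in> U}"
proof -
  have "open ((\<lambda>s. (s, v)) -` U)" "open ((\<lambda>t. (u, t)) -` U)"
    by (intro open_vimage assms continuous_intros)+
  then show "open {s. (s, v) \<in> U}" "open {t. (u, t) \<in> U}"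
    by (simp_all add: vimage_def)
qed

text \<open>Each derivative depends only on the values near the point. This transfers statements
  from a harmonic polynomial to its cutoff, and shows that the partial derivatives of a test
  function vanish off its support.\<close>

lemma partials_cong_open:
  assumes "open U" "\<And>u v. (u, v) \<in> U \<Longrightarrow> f u v = g u v" "(u, v) \<in> U"
  shows "partials is f u v = partials is g u v"
  using assms(3)
proof (induction "is" arbitrary: u v)
  case Nil
  then show ?case using assms(2) by simp
next
  case (Cons i "is")
  have "eventually (\<lambda>s. (s, v) \<in> U) (nhds u)" "eventually (\<lambda>t. (u, t) \<in> U) (nhds v)"
    using eventually_nhds_in_open[OF open_slices(1)[OF assms(1), of v], of u]
      eventually_nhds_in_open[OF open_slices(2)[OF assms(1), of u], of v] Cons.prems by auto
  then have "eventually (\<lambda>s. s \<in> UNIV \<longrightarrow> partials is f s v = partials is g s v) (nhds u)"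
    "eventually (\<lambda>t. t \<in> UNIV \<longrightarrow> partials is f u t = partials is g u t) (nhds v)"
    using Cons.IH by (auto elim: eventually_mono)
  then show ?case
    by (auto simp: partial_def intro!: vector_derivative_cong_eq)
qed

lemma smooth_on_cong:
  assumes "open U" "\<And>u v. (u, v) \<in> U \<Longrightarrow> f u v = g u v" "smooth_on U g"
  shows "smooth_on U f"
proof -
  have eq: "partials is f u v = partials is g u v" if "(u, v) \<in> U" for "is" u v
    by (rule partials_cong_open[OF assms(1) _ that]) (rule assms(2))
  have "(\<lambda>s. partials is f s v) differentiable (at u)" "(\<lambda>t. partials is f u t) differentiable (at v)"
    if uv: "(u, v) \<in> U" for "is" u v
  proof -
    note op = open_slices[OF assms(1)]
    have "(\<lambda>s. partials is g s v) differentiable (at u)" "(\<lambda>t. partials is g u t) differentiable (at v)"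
      using assms(3) uv by (auto simp: smooth_on_def)
    then show "(\<lambda>s. partials is f s v) differentiable (at u)" "(\<lambda>t. partials is f u t) differentiable (at v)"
      unfolding differentiable_def
      using has_derivative_transform_within_open[OF _ op(1), of _ _ u UNIV v]
        has_derivative_transform_within_open[OF _ op(2), of _ _ v UNIV u] uv eq
      by (metis (no_types, lifting) mem_Collect_eq)+
  qed
  moreover have "continuous_on U (\<lambda>(u, v). partials is f u v)" for "is"
    using assms(3) eq by (subst continuous_on_cong[OF refl, of _ _ "\<lambda>(u, v). partials is g u v"]) (auto simp: smooth_on_def)
  ultimately show ?thesis by (auto simp: smooth_on_def)
qed

lemma smooth_on_trig_poly: "smooth_on U (trig_poly N p q)"
  unfolding smooth_on_def
proof (intro allI conjI ballI, goal_cases)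
  case (1 "is")
  show ?case using partials_trig_poly[of "is" N p q] continuous_on_trig_poly by metis
next
  case (2 "is" x)
  obtain p' q' where eq: "partials is (trig_poly N p q) = trig_poly N p' q'"
    using partials_trig_poly by blast
  have "(\<lambda>s. trig_poly N p' q' s v) differentiable (at u)" "(\<lambda>t. trig_poly N p' q' u t) differentiable (at v)" for u v
    unfolding real_differentiable_def
    by (rule exI, rule trig_poly_has_derivative_1) (rule exI, rule trig_poly_has_derivative_2)
  then show ?case
    unfolding eq by (cases x) simp
qed

section \<open>Weak derivatives of harmonic polynomials\<close>

text \<open>Integration by parts: \<open>F + G\<close> is the derivative of the product of
  \<open>f\<close> and the test function along one coordinate, so its integral over each line of a
  large box is a boundary term, which is zero.\<close>

lemma weak_partialI:
  fixes f w g :: "real \<times> real \<Rightarrow> real"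
  assumes cont: "continuous_on UNIV f" "continuous_on UNIV w"
    and d1: "i = 1 \<Longrightarrow> \<forall>x y. ((\<lambda>s. f (s, y)) has_real_derivative w (x, y)) (at x)"
    and d2: "i = 2 \<Longrightarrow> \<forall>x y. ((\<lambda>t. f (x, t)) has_real_derivative w (x, y)) (at y)"
    and eq: "\<And>p. p \<in> \<Omega> \<Longrightarrow> g p = f p"
  shows "weak_partial i \<Omega> g w"
  unfolding weak_partial_def
proof (intro allI impI)
  fix \<psi> assume "test_function \<Omega> \<psi>"
  then obtain K where sm: "smooth_on UNIV \<psi>" and K: "compact K" "K \<subseteq> \<Omega>"
    and \<psi>0: "\<And>x y. (x, y) \<notin> K \<Longrightarrow> \<psi> x y = 0"
    unfolding test_function_def by blast
  have c0: "continuous_on UNIV (\<lambda>p. \<psi> (fst p) (snd p))"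
    and c1: "continuous_on UNIV (\<lambda>p. partial i \<psi> (fst p) (snd p))"
    using sm[unfolded smooth_on_def, rule_format, of "[]"] sm[unfolded smooth_on_def, rule_format, of "[i]"]
    by (auto simp: split_beta)
  have "(\<lambda>s. \<psi> s y) differentiable (at x)" "(\<lambda>t. \<psi> x t) differentiable (at y)" for x y
    using sm[unfolded smooth_on_def, rule_format, of "[]"] by auto
  then have \<psi>1: "((\<lambda>s. \<psi> s y) has_real_derivative partial 1 \<psi> x y) (at x)"
    and \<psi>2: "((\<lambda>t. \<psi> x t) has_real_derivative partial 2 \<psi> x y) (at y)" for x y
    by (auto simp: partial_def vector_derivative_works has_real_derivative_iff_has_vector_derivative)
  have \<psi>'0: "partial i \<psi> x y = 0" if "(x, y) \<notin> K" for x y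
  proof -
    have "partials [i] \<psi> x y = partials [i] (\<lambda>_ _. 0) x y"
      using open_Compl[OF compact_imp_closed[OF K(1)]] by (rule partials_cong_open) (use that \<psi>0 in auto)
    then show ?thesis by (simp add: partial_def)
  qed
  \<comment> \<open>The bound is strict, so the edges of the box lie outside
    \<open>K\<close>.\<close>
  obtain M where M: "\<And>p. p \<in> K \<Longrightarrow> norm p < M"
    using compact_imp_bounded[OF K(1)] unfolding bounded_pos_less by blast
  have outside: "(x, y) \<notin> K" if "M \<le> \<bar>x\<bar> \<or> M \<le> \<bar>y\<bar>" for x y
    using M[of "(x, y)"] that norm_fst_le[of x y] norm_snd_le[of y x] by auto
  have edge: "\<psi> M y = 0" "\<psi> (- M) y = 0" "\<psi> y M = 0" "\<psi> y (- M) = 0" for y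
    by (rule \<psi>0, rule outside, simp add: abs_ge_self)+
  let ?box = "cbox (- M, - M) (M, M)"
  have restrict: "(LINT p:\<Omega>|lborel. F p) = integral ?box F"
    if "continuous_on UNIV F" "\<And>p. p \<notin> K \<Longrightarrow> F p = 0" for F :: "real \<times> real \<Rightarrow> real"
  proof -
    have "p \<in> ?box" if "p \<in> K" for p
    proof -
      have "\<not> M \<le> \<bar>fst p\<bar>" "\<not> M \<le> \<bar>snd p\<bar>"
        using outside[of "fst p" "snd p"] that by auto
      then show ?thesis by (cases p) (auto simp: cbox_Pair_eq)
    qed
    then have "indicator \<Omega> p *\<^sub>R F p = indicator ?box p *\<^sub>R F p" for p
      using that(2)[of p] K(2) by (cases "p \<in> K") (auto simp: indicator_def)
    then have "(LINT p:\<Omega>|lborel. F p) = (LINT p:?box|lborel. F p)"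
      unfolding set_lebesgue_integral_def by (simp only:)
    also have "\<dots> = integral ?box F"
      using borel_integrable_compact[of ?box F] continuous_on_subset[OF that(1)]
      by (intro set_borel_integral_eq_integral) (simp add: set_integrable_def)
    finally show ?thesis .
  qed
  define F G where "F = (\<lambda>p. f p * partial i \<psi> (fst p) (snd p))" and "G = (\<lambda>p. w p * \<psi> (fst p) (snd p))"
  have cF: "continuous_on S F" and cG: "continuous_on S G" for S
    unfolding F_def G_def using cont c0 c1 by (auto intro!: continuous_on_mult elim: continuous_on_subset)
  have "integral ?box (\<lambda>p. F p + G p) = 0"
  proof -
    have cFG: "continuous_on S (\<lambda>(x, y). F (x, y) + G (x, y))" for S
      using cF cG by (simp add: split_beta continuous_on_add)
    consider "i = 1" | "i = 2" using exhaust_2 by blast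
    then show ?thesis
    proof cases
      case 1
      have zero: "integral {-M..M} (\<lambda>x. F (x, y) + G (x, y)) = 0" for y
      proof (cases "- M \<le> M")
        case True
        have "((\<lambda>x. F (x, y) + G (x, y)) has_integral f (M, y) * \<psi> M y - f (- M, y) * \<psi> (- M) y) {-M..M}"
        proof (rule fundamental_theorem_of_calculus[OF True])
          fix x
          have "((\<lambda>x. f (x, y) * \<psi> x y) has_real_derivative F (x, y) + G (x, y)) (at x within {-M..M})"
            by (rule has_field_derivative_at_within)
              (use d1[OF 1] \<psi>1 in \<open>auto intro!: derivative_eq_intros simp: F_def G_def 1\<close>)
          then show "((\<lambda>x. f (x, y) * \<psi> x y) has_vector_derivative F (x, y) + G (x, y)) (at x within {-M..M})"
            by (simp add: has_real_derivative_iff_has_vector_derivative)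
        qed
        then show ?thesis by (simp add: edge integral_unique)
      qed simp
      \<comment> \<open>For \<open>i = 1\<close> the inner integral has to run over
        \<open>x\<close>, hence the exchange of order.\<close>
      have "integral ?box (\<lambda>(x, y). F (x, y) + G (x, y)) =
          integral (cbox (- M) M) (\<lambda>y. integral (cbox (- M) M) (\<lambda>x. F (x, y) + G (x, y)))"
        using integral_prod_continuous[of "- M" "- M" M M "\<lambda>(x, y). F (x, y) + G (x, y)", OF cFG]
          integral_swap_continuous[of "- M" "- M" M M "\<lambda>x y. F (x, y) + G (x, y)", OF cFG] by simp
      then show ?thesis by (simp add: zero case_prod_beta')
    next
      case 2
      have zero: "integral {-M..M} (\<lambda>y. F (x, y) + G (x, y)) = 0" for x
      proof (cases "- M \<le> M")
        case True
        have "((\<lambda>y. F (x, y) + G (x, y)) has_integral f (x, M) * \<psi> x M - f (x, - M) * \<psi> x (- M)) {-M..M}"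
        proof (rule fundamental_theorem_of_calculus[OF True])
          fix y
          have "((\<lambda>y. f (x, y) * \<psi> x y) has_real_derivative F (x, y) + G (x, y)) (at y within {-M..M})"
            by (rule has_field_derivative_at_within)
              (use d2[OF 2] \<psi>2 in \<open>auto intro!: derivative_eq_intros simp: F_def G_def 2\<close>)
          then show "((\<lambda>y. f (x, y) * \<psi> x y) has_vector_derivative F (x, y) + G (x, y)) (at y within {-M..M})"
            by (simp add: has_real_derivative_iff_has_vector_derivative)
        qed
        then show ?thesis by (simp add: edge integral_unique)
      qed simp
      have "integral ?box (\<lambda>(x, y). F (x, y) + G (x, y)) =
          integral (cbox (- M) M) (\<lambda>x. integral (cbox (- M) M) (\<lambda>y. F (x, y) + G (x, y)))"
        using integral_prod_continuous[of "- M" "- M" M M "\<lambda>(x, y). F (x, y) + G (x, y)", OF cFG] by simp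
      then show ?thesis by (simp add: zero case_prod_beta')
    qed
  qed
  moreover have "integral ?box (\<lambda>p. F p + G p) = integral ?box F + integral ?box G"
    by (intro integral_add integrable_continuous cF cG)
  ultimately have "integral ?box F = - integral ?box G" by linarith
  then have "(LINT p:\<Omega>|lborel. F p) = - (LINT p:\<Omega>|lborel. G p)"
    using restrict[of F] restrict[of G] cF cG \<psi>0 \<psi>'0 by (simp add: F_def G_def)
  moreover have "(LINT (x, y):\<Omega>|lborel. g (x, y) * partial i \<psi> x y) = (LINT p:\<Omega>|lborel. F p)"
    unfolding set_lebesgue_integral_def
    by (rule Bochner_Integration.integral_cong) (auto simp: F_def eq indicator_def)
  moreover have "(LINT (x, y):\<Omega>|lborel. w (x, y) * \<psi> x y) = (LINT p:\<Omega>|lborel. G p)"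
    by (simp add: G_def case_prod_beta')
  ultimately show "(LINT (x, y):\<Omega>|lborel. g (x, y) * partial i \<psi> x y) = - (LINT (x, y):\<Omega>|lborel. w (x, y) * \<psi> x y)"
    by simp
qed

lemma L2_spaceI:
  assumes "continuous_on UNIV f" "\<Omega> \<in> sets lborel" "bounded \<Omega>" and eq: "\<And>p. p \<in> \<Omega> \<Longrightarrow> g p = f p"
  shows "g \<in> L2_space \<Omega>"
proof -
  have "(\<lambda>p. indicator \<Omega> p *\<^sub>R g p) = (\<lambda>p. indicator \<Omega> p *\<^sub>R f p)" 
    "(\<lambda>p. indicator \<Omega> p *\<^sub>R (g p)\<^sup>2) = (\<lambda>p. indicator \<Omega> p *\<^sub>R (f p)\<^sup>2)"
    using eq by (auto simp: indicator_def)
  moreover have "f \<in> borel_measurable lborel"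
    using assms(1) by (simp add: borel_measurable_continuous_onI)
  then have "(\<lambda>p. indicator \<Omega> p *\<^sub>R f p) \<in> borel_measurable lborel"
    using assms(2) by measurable
  moreover have "set_integrable lborel \<Omega> (\<lambda>p. (f p)\<^sup>2)"
  proof (rule set_integrable_subset[OF _ assms(2) closure_subset])
    show "set_integrable lborel (closure \<Omega>) (\<lambda>p. (f p)\<^sup>2)"
      unfolding set_integrable_def using assms(1,3)
      by (intro borel_integrable_compact continuous_intros continuous_on_subset[OF assms(1)])
        (auto simp: compact_closure)
  qed
  ultimately show ?thesis
    by (simp add: L2_space_def set_borel_measurable_def set_integrable_def)
qed

text \<open>By the Cauchy-Riemann equations the derivatives of \<open>Re p\<close> are the real
  parts of \<open>p'\<close> and \<open>\<i> * p'\<close>, again of the same kind, and such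
  functions are bounded on bounded sets.\<close>

lemma Re_poly_H1:
  fixes p :: "complex poly"
  assumes "\<Omega> \<in> sets lborel" "bounded \<Omega>" and eq: "\<And>x y. (x, y) \<in> \<Omega> \<Longrightarrow> g (x, y) = Re (poly p (Complex x y))"
  shows "g \<in> H1_space \<Omega>"
proof -
  define f where "f p = (\<lambda>q. Re (poly p (Complex (fst q) (snd q))))" for p
  have cont: "continuous_on UNIV (f p)" for p
    unfolding f_def Complex_eq by (intro continuous_intros)
  have g: "g q = f p q" if "q \<in> \<Omega>" for q
    using eq[of "fst q" "snd q"] that by (simp add: f_def)
  have d: "((\<lambda>z. poly p z) has_derivative (\<lambda>h. poly (pderiv p) z * h)) (at z)" for z
    using poly_DERIV[of p z] by (simp add: has_field_derivative_def)
  have "((\<lambda>s. f p (s, y)) has_real_derivative f (pderiv p) (x, y)) (at x)" for x y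
    unfolding f_def Complex_eq has_field_derivative_def
    by (auto intro!: derivative_eq_intros has_derivative_compose[OF _ d] simp: fun_eq_iff)
  then have "weak_partial 1 \<Omega> g (f (pderiv p))"
    by (intro weak_partialI[of "f p"] cont g) auto
  moreover have "((\<lambda>t. f p (x, t)) has_real_derivative f (smult \<i> (pderiv p)) (x, y)) (at y)" for x y
    unfolding f_def Complex_eq has_field_derivative_def
    by (auto intro!: derivative_eq_intros has_derivative_compose[OF _ d] simp: fun_eq_iff)
  then have "weak_partial 2 \<Omega> g (f (smult \<i> (pderiv p)))"
    by (intro weak_partialI[of "f p"] cont g) auto
  moreover have "f p \<in> L2_space \<Omega>" for p
    by (rule L2_spaceI[OF cont assms(1,2)]) simp
  moreover have "g \<in> L2_space \<Omega>"
    by (rule L2_spaceI[OF cont assms(1,2) g])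
  ultimately show ?thesis
    unfolding H1_space_def by (auto simp: forall_2)
qed

section \<open>The index\<close>

lemma has_integral_cos_int:
  "((\<lambda>v. cos (of_int m * v)) has_integral (if m = 0 then 2 * pi else 0)) {0..2 * pi}"
proof (cases "m = 0")
  case True
  then show ?thesis using has_integral_const_real[of "1::real" 0 "2 * pi"] by simp
next
  case False
  have "((\<lambda>v. cos (of_int m * v)) has_integral sin (of_int m * (2 * pi)) / m - sin (of_int m * 0) / m) {0..2 * pi}"
    using False
    by (intro fundamental_theorem_of_calculus)
      (auto intro!: derivative_eq_intros simp flip: has_real_derivative_iff_has_vector_derivative)
  then show ?thesis using False sin_int_2pin[of m] by (simp add: mult_ac)
qed

lemma has_integral_sin_int: "((\<lambda>v. sin (of_int m * v)) has_integral 0) {0..2 * pi}"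
proof (cases "m = 0")
  case False
  have "((\<lambda>v. sin (of_int m * v)) has_integral - cos (of_int m * (2 * pi)) / m - - cos (of_int m * 0) / m) {0..2 * pi}"
    using False
    by (intro fundamental_theorem_of_calculus)
      (auto intro!: derivative_eq_intros simp flip: has_real_derivative_iff_has_vector_derivative)
  then show ?thesis using False cos_int_2pin[of m] by (simp add: mult_ac)
qed simp

text \<open>The product is a combination of sines and cosines of \<open>j - k\<close> and
  \<open>j + k\<close> times \<open>v\<close>. Positivity keeps \<open>j + k\<close> away from
  \<open>0\<close>, so a contribution remains only for \<open>j = k\<close>.\<close>

lemma trig_monomials_orthogonal:
  fixes j k :: nat
  assumes "j > 0" "k > 0"
  shows "((\<lambda>v. (a * cos (real j * v) + b * sin (real j * v)) * (c * cos (real k * v) + d * sin (real k * v)))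
    has_integral (if j = k then pi * (a * c + b * d) else 0)) {0..2 * pi}"
proof -
  define s t where "s = int j - int k" and "t = int j + int k"
  have st: "of_int s * v = real j * v - real k * v" "of_int t * v = real j * v + real k * v" for v :: real
    by (simp_all add: s_def t_def algebra_simps)
  have "((\<lambda>v. (a * c + b * d) / 2 * cos (of_int s * v) + (a * c - b * d) / 2 * cos (of_int t * v)
      + ((b * c - a * d) / 2 * sin (of_int s * v) + (a * d + b * c) / 2 * sin (of_int t * v)))
    has_integral (a * c + b * d) / 2 * (if s = 0 then 2 * pi else 0) + (a * c - b * d) / 2 * (if t = 0 then 2 * pi else 0)
      + ((b * c - a * d) / 2 * 0 + (a * d + b * c) / 2 * 0)) {0..2 * pi}"
    by (intro has_integral_add has_integral_mult_right has_integral_cos_int has_integral_sin_int)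
  moreover have "(a * c + b * d) / 2 * cos (of_int s * v) + (a * c - b * d) / 2 * cos (of_int t * v)
      + ((b * c - a * d) / 2 * sin (of_int s * v) + (a * d + b * c) / 2 * sin (of_int t * v))
     = (a * cos (real j * v) + b * sin (real j * v)) * (c * cos (real k * v) + d * sin (real k * v))" for v
    unfolding st cos_add cos_diff sin_add sin_diff by (simp add: field_simps)
  moreover have "t \<noteq> 0" "s = 0 \<longleftrightarrow> j = k" using assms by (auto simp: s_def t_def)
  ultimately show ?thesis by (cases "j = k") (simp_all add: mult.commute)
qed

lemma trig_poly_parseval:
  "((\<lambda>v. (trig_poly N p q u v)\<^sup>2) has_integral pi * (\<Sum>k\<in>{1..N}. (poly (p k) u)\<^sup>2 + (poly (q k) u)\<^sup>2)) {0..2 * pi}"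
proof -
  have "((\<lambda>v. \<Sum>j\<in>{1..N}. \<Sum>k\<in>{1..N}. (poly (p j) u * cos (real j * v) + poly (q j) u * sin (real j * v))
      * (poly (p k) u * cos (real k * v) + poly (q k) u * sin (real k * v)))
    has_integral (\<Sum>j\<in>{1..N}. \<Sum>k\<in>{1..N}. if j = k then pi * (poly (p j) u * poly (p k) u + poly (q j) u * poly (q k) u) else 0)) {0..2 * pi}"
    by (intro has_integral_sum trig_monomials_orthogonal) auto
  moreover have "(trig_poly N p q u v)\<^sup>2 = (\<Sum>j\<in>{1..N}. \<Sum>k\<in>{1..N}.
      (poly (p j) u * cos (real j * v) + poly (q j) u * sin (real j * v))
      * (poly (p k) u * cos (real k * v) + poly (q k) u * sin (real k * v)))" for v
    unfolding trig_poly_def power2_eq_square by (rule sum_product)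
  ultimately show ?thesis
    by (simp add: power2_eq_square sum_distrib_left)
qed

section \<open>Harmonic polynomials and their second variation\<close>

definition harmonic :: "nat \<Rightarrow> (nat \<Rightarrow> real) \<Rightarrow> (nat \<Rightarrow> real) \<Rightarrow> real \<Rightarrow> real \<Rightarrow> real" where
  "harmonic N a b = trig_poly N (\<lambda>k. monom (a k) k) (\<lambda>k. monom (b k) k)"

lemma harmonic_eq: "harmonic N a b u v = (\<Sum>k\<in>{1..N}. u ^ k * (a k * cos (real k * v) + b k * sin (real k * v)))"
  by (simp add: harmonic_def trig_poly_def poly_monom algebra_simps)

text \<open>The coefficient \<open>a - \<i> * b\<close> is what turns \<open>cis (k * v)\<close>
  into \<open>a * cos (k * v) + b * sin (k * v)\<close>. Periodicity and membership in the Sobolev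
  space are read off from this form.\<close>

lemma harmonic_Re_poly:
  "harmonic N a b u v = Re (poly (\<Sum>k\<in>{1..N}. monom (Complex (a k) (- b k)) k) (of_real u * cis v))"
  by (simp add: harmonic_eq poly_sum poly_monom power_mult_distrib Complex.DeMoivre algebra_simps flip: of_real_power)

lemma harmonic_periodic: "harmonic N a b u (v + 2 * pi) = harmonic N a b u v"
proof -
  have "cis (v + 2 * pi) = cis v" by (simp add: complex_eq_iff)
  then show ?thesis by (simp add: harmonic_Re_poly)
qed

text \<open>The components \<open>\<partial>\<^sub>u\<close> and \<open>u\<^sup>-\<^sup>1 \<partial>\<^sub>v\<close> of the gradient in the orthonormal polar frame.\<close>

definition harmonic_gradient_1 where
  "harmonic_gradient_1 N a b = trig_poly N (\<lambda>k. monom (real k * a k) (k - 1)) (\<lambda>k. monom (real k * b k) (k - 1))"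

definition harmonic_gradient_2 where
  "harmonic_gradient_2 N a b = trig_poly N (\<lambda>k. monom (real k * b k) (k - 1)) (\<lambda>k. monom (- (real k * a k)) (k - 1))"

lemma harmonic_partial_1: "partial 1 (harmonic N a b) u v = harmonic_gradient_1 N a b u v"
proof (rule partial_1I)
  show "((\<lambda>u. harmonic N a b u v) has_vector_derivative harmonic_gradient_1 N a b u v) (at u)"
    unfolding harmonic_def harmonic_gradient_1_def
    using trig_poly_has_derivative_1[of N "\<lambda>k. monom (a k) k" "\<lambda>k. monom (b k) k" v u]
    by (simp add: pderiv_monom flip: has_real_derivative_iff_has_vector_derivative)
qed

lemma harmonic_partial_2: "partial 2 (harmonic N a b) u v = u * harmonic_gradient_2 N a b u v"
proof (rule partial_2I)
  have "trig_poly N (\<lambda>k. smult (real k) (monom (b k) k)) (\<lambda>k. - smult (real k) (monom (a k) k)) u v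
    = u * harmonic_gradient_2 N a b u v"
    unfolding trig_poly_def harmonic_gradient_2_def sum_distrib_left
  proof (rule sum.cong)
    fix k assume "k \<in> {1..N}"
    then have "u ^ k = u * u ^ (k - 1)" by (cases k) auto
    then show "poly (smult (real k) (monom (b k) k)) u * cos (real k * v) + poly (- smult (real k) (monom (a k) k)) u * sin (real k * v)
      = u * (poly (monom (real k * b k) (k - 1)) u * cos (real k * v) + poly (monom (- (real k * a k)) (k - 1)) u * sin (real k * v))"
      by (simp add: poly_monom algebra_simps)
  qed simp
  then show "((\<lambda>v. harmonic N a b u v) has_vector_derivative u * harmonic_gradient_2 N a b u v) (at v)"
    unfolding harmonic_def
    using trig_poly_has_derivative_2[of N "\<lambda>k. monom (a k) k" "\<lambda>k. monom (b k) k" u v]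
    by (simp flip: has_real_derivative_iff_has_vector_derivative)
qed

text \<open>By Parseval both gradient components have the same integral over the circle, so mode
  \<open>k\<close> has energy density \<open>2 * k\<^sup>2 * u ^ (2 * k - 1)\<close>, with primitive
  \<open>k * u ^ (2 * k)\<close>. Writing the angular derivative as \<open>u\<close> times a
  trigonometric polynomial removes the division by \<open>u\<close>.\<close>

lemma second_variation_harmonic:
  assumes R: "R > 0"
    and \<phi>: "\<And>u v. u \<in> {0<..<R} \<Longrightarrow> \<phi> u v = harmonic N a b u v"
  shows "enneper_Q 5 R \<phi> = pi * (\<Sum>k\<in>{1..N}. ((a k)\<^sup>2 + (b k)\<^sup>2) * (real k * R ^ (2 * k) - integral {0..R} (weight k)))"
proof -
  let ?h = "harmonic N a b" and ?g1 = "harmonic_gradient_1 N a b" and ?g2 = "harmonic_gradient_2 N a b"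
  define c where "c k = (a k)\<^sup>2 + (b k)\<^sup>2" for k
  define F where "F u v = u * ((?g1 u v)\<^sup>2 + (?g2 u v)\<^sup>2) - weight 0 u * (?h u v)\<^sup>2" for u v
  have "enneper_Q 5 R \<phi> = (LINT (u, v):{0<..<R} \<times> {0<..<2 * pi}|lborel. F u v)"
    unfolding enneper_Q_def
  proof (rule second_variation_enneper)
    fix u v assume "(u, v) \<in> {0<..<R} \<times> {0<..<2 * pi}"
    then have u: "u > 0" and uv: "(u, v) \<in> {0<..<R} \<times> UNIV" by auto
    have "partials [i] \<phi> u v = partials [i] ?h u v" for i
      by (rule partials_cong_open[OF _ _ uv]) (auto simp: \<phi> open_Times)
    then have p: "partial 1 \<phi> u v = ?g1 u v" "partial 2 \<phi> u v = u * ?g2 u v"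
      by (simp_all add: harmonic_partial_1 harmonic_partial_2)
    show "F u v = u * (partial 1 \<phi> u v)\<^sup>2 + (partial 2 \<phi> u v)\<^sup>2 / u
        - 8 * (real 5)\<^sup>2 * (u ^ 5)\<^sup>2 / (u * (1 + (u ^ 5)\<^sup>2)\<^sup>2) * (\<phi> u v)\<^sup>2"
      using u uv unfolding p weight_0[OF u]
      by (simp add: F_def \<phi> power_mult_distrib power2_eq_square distrib_left)
  qed (auto simp: open_Times)
  also have "\<dots> = integral {0..R} (\<lambda>u. integral {0..2 * pi} (F u))"
  proof (rule set_lebesgue_integral_rectangle)
    have tp: "continuous_on S (\<lambda>x. trig_poly N p q (fst x) (snd x))" for S p q
      using continuous_on_trig_poly[of S N p q] by (simp add: split_beta)
    show "continuous_on ({0..R} \<times> {0..2 * pi}) (\<lambda>(u, v). F u v)"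
      unfolding F_def split_beta harmonic_def harmonic_gradient_1_def harmonic_gradient_2_def
      by (intro continuous_intros tp continuous_on_compose2[OF continuous_on_weight]) auto
  qed
  also have "\<dots> = integral {0..R} (\<lambda>u. pi * (\<Sum>k\<in>{1..N}. c k * (real k * (2 * k) * u ^ (2 * k - 1) - weight k u)))"
  proof (rule integral_cong)
    fix u
    define d where "d k = (real k * u ^ (k - 1))\<^sup>2" for k
    have g: "((\<lambda>v. (?g1 u v)\<^sup>2) has_integral pi * (\<Sum>k\<in>{1..N}. c k * d k)) {0..2 * pi}"
      "((\<lambda>v. (?g2 u v)\<^sup>2) has_integral pi * (\<Sum>k\<in>{1..N}. c k * d k)) {0..2 * pi}"
      "((\<lambda>v. (?h u v)\<^sup>2) has_integral pi * (\<Sum>k\<in>{1..N}. c k * (u ^ k)\<^sup>2)) {0..2 * pi}"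
      using trig_poly_parseval[of N "\<lambda>k. monom (real k * a k) (k - 1)" "\<lambda>k. monom (real k * b k) (k - 1)" u]
        trig_poly_parseval[of N "\<lambda>k. monom (real k * b k) (k - 1)" "\<lambda>k. monom (- (real k * a k)) (k - 1)" u]
        trig_poly_parseval[of N "\<lambda>k. monom (a k) k" "\<lambda>k. monom (b k) k" u]
      unfolding harmonic_def harmonic_gradient_1_def harmonic_gradient_2_def
      by (simp_all add: poly_monom c_def d_def power_mult_distrib algebra_simps)
    have "(F u has_integral u * (pi * (\<Sum>k\<in>{1..N}. c k * d k) + pi * (\<Sum>k\<in>{1..N}. c k * d k))
        - weight 0 u * (pi * (\<Sum>k\<in>{1..N}. c k * (u ^ k)\<^sup>2))) {0..2 * pi}"
      unfolding F_def by (intro has_integral_diff has_integral_mult_right has_integral_add g)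
    then have "integral {0..2 * pi} (F u) = u * (pi * (\<Sum>k\<in>{1..N}. c k * d k) + pi * (\<Sum>k\<in>{1..N}. c k * d k))
        - weight 0 u * (pi * (\<Sum>k\<in>{1..N}. c k * (u ^ k)\<^sup>2))"
      by (rule integral_unique)
    also have "\<dots> = pi * (\<Sum>k\<in>{1..N}. c k * (2 * u * d k - weight 0 u * (u ^ k)\<^sup>2))"
      by (simp add: algebra_simps sum_subtractf sum_distrib_left sum.distrib)
    also have "(\<Sum>k\<in>{1..N}. c k * (2 * u * d k - weight 0 u * (u ^ k)\<^sup>2))
        = (\<Sum>k\<in>{1..N}. c k * (real k * (2 * k) * u ^ (2 * k - 1) - weight k u))"
    proof (rule sum.cong)
      fix k assume "k \<in> {1..N}"
      then obtain m where "k = Suc m" by (cases k) auto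
      then have "u ^ (2 * k - 1) = u * (u ^ (k - 1))\<^sup>2"
        by (simp add: power_even_eq)
      then have "2 * u * d k = real k * (2 * k) * u ^ (2 * k - 1)"
        by (simp only: d_def power_mult_distrib) (simp add: power2_eq_square)
      then show "c k * (2 * u * d k - weight 0 u * (u ^ k)\<^sup>2) = c k * (real k * (2 * k) * u ^ (2 * k - 1) - weight k u)"
        by (simp add: weight_shift[of k] power_even_eq)
    qed simp
    finally show "integral {0..2 * pi} (F u) = pi * (\<Sum>k\<in>{1..N}. c k * (real k * (2 * k) * u ^ (2 * k - 1) - weight k u))" .
  qed
  also have "\<dots> = pi * (\<Sum>k\<in>{1..N}. c k * (real k * R ^ (2 * k) - integral {0..R} (weight k)))"
  proof (rule integral_unique, intro has_integral_mult_right has_integral_sum has_integral_diff)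
    fix k assume "k \<in> {1..N}"
    then have k: "k > 0" by simp
    have "((\<lambda>u. real k * (2 * k) * u ^ (2 * k - 1)) has_integral real k * R ^ (2 * k) - real k * 0 ^ (2 * k)) {0..R}"
      using R by (intro fundamental_theorem_of_calculus)
        (auto intro!: derivative_eq_intros simp flip: has_real_derivative_iff_has_vector_derivative)
    then show "((\<lambda>u. real k * (2 * k) * u ^ (2 * k - 1)) has_integral real k * R ^ (2 * k)) {0..R}"
      using k by (simp add: power_0_left)
    show "(weight k has_integral integral {0..R} (weight k)) {0..R}"
      by (intro integrable_integral integrable_continuous_interval continuous_intros)
  qed simp
  finally show ?thesis unfolding c_def .
qed

text \<open>For \<open>k = 3\<close> the comparison is roughly \<open>7.37\<close> against
  \<open>8.87\<close>. For \<open>k = 4\<close> the same lower bound, about \<open>8.2\<close>,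
  falls short of \<open>4 * R ^ 8\<close>, about \<open>13.3\<close>.\<close>

lemma weight_dominates:
  assumes R: "1.1616 \<le> R" "R < 1.1617" and k: "k \<in> {1..3}"
  shows "real k * R ^ (2 * k) < integral {0..R} (weight k)"
proof -
  have "real k * R ^ (2 * k) \<le> real k * 1.1617 ^ (2 * k)"
    using R by (intro mult_left_mono power_mono) auto
  also have "\<dots> < 20 * (0.85 ^ (2 * k) * (1 / (1 + 0.85 ^ 10) - 1 / 2) + (1 / 2 - 1 / (1 + 1.1616 ^ 10)))"
  proof -
    have "k = 1 \<or> k = 2 \<or> k = 3" using k by auto
    then show ?thesis by (elim disjE) (simp_all add: eval_nat_numeral)
  qed
  also have "\<dots> \<le> integral {0..R} (weight k)" by (rule weight_integral_lower[OF R(1)])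
  finally show ?thesis .
qed

definition cutoff_harmonic :: "nat \<Rightarrow> real \<Rightarrow> (nat \<Rightarrow> real) \<Rightarrow> (nat \<Rightarrow> real) \<Rightarrow> real \<Rightarrow> real \<Rightarrow> real" where
  "cutoff_harmonic N R a b u v = (if u \<in> {0<..<R} then harmonic N a b u v else 0)"

lemma cutoff_harmonic_function_space: "cutoff_harmonic N R a b \<in> function_space R"
proof -
  let ?\<phi> = "cutoff_harmonic N R a b" and ?U = "{0<..<R} \<times> (UNIV :: real set)"
  have U: "open ?U" by (simp add: open_Times)
  have eq: "?\<phi> u v = harmonic N a b u v" if "(u, v) \<in> ?U" for u v
    using that by (auto simp: cutoff_harmonic_def)
  have "smooth_on ?U ?\<phi>"
    using smooth_on_trig_poly unfolding harmonic_def[symmetric]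
    by (intro smooth_on_cong[OF U eq]) (simp_all add: harmonic_def smooth_on_trig_poly)
  moreover have "bounded ((\<lambda>(u, v). partials is ?\<phi> u v) ` ?U)" for "is"
  proof -
    obtain p q where pq: "partials is (harmonic N a b) = trig_poly N p q"
      using partials_trig_poly unfolding harmonic_def by blast
    have "(\<lambda>(u, v). partials is ?\<phi> u v) ` ?U = (\<lambda>(u, v). trig_poly N p q u v) ` ?U"
      unfolding pq[symmetric] by (rule image_cong) (use partials_cong_open[OF U eq] in auto)
    then show ?thesis using trig_poly_bounded[of "{0<..<R}" N p q] by simp
  qed
  moreover have "on_disc ?\<phi> \<in> H1_space (disc R)"
  proof (rule Re_poly_H1)
    fix x y assume xy: "(x, y) \<in> disc R"
    define z where "z = Complex x y"
    have z: "norm z < R" "of_real (norm z) * cis (Arg2pi z) = z"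
      using xy by (simp add: z_def disc_def norm_prod_def complex_norm flip: zero_prod_def)
        (simp add: complex_eq_iff cos_Arg2pi sin_Arg2pi)
    have "on_disc ?\<phi> (x, y) = ?\<phi> (norm z) (Arg2pi z)"
      by (simp add: on_disc_def z_def complex_norm)
    \<comment> \<open>At the origin the cutoff is \<open>0\<close>, and so is a sum that starts at
      \<open>k = 1\<close>; the identity therefore holds on the whole disc.\<close>
    also have "\<dots> = harmonic N a b (norm z) (Arg2pi z)"
      using z(1) by (auto simp: cutoff_harmonic_def harmonic_eq intro!: sum.neutral)
    finally show "on_disc ?\<phi> (x, y) = Re (poly (\<Sum>k\<in>{1..N}. monom (Complex (a k) (- b k)) k) (Complex x y))"
      by (simp add: harmonic_Re_poly z(2)) (simp add: z_def)
  qed (auto simp: disc_def)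
  ultimately show ?thesis
    by (auto simp: function_space_def cutoff_harmonic_def harmonic_periodic)
qed

lemma ind_b_ge_6:
  assumes R: "1.1616 \<le> R" "R < 1.1617"
  shows "6 \<le> ind_b 5 R"
proof -
  \<comment> \<open>The index type \<open>3\<close> is arithmetic modulo \<open>3\<close>, so
    \<open>of_nat k\<close> for \<open>k = 1, 2, 3\<close> meets each index once and the
    coefficients are six free reals.\<close>
  define L :: "(real^3) \<times> (real^3) \<Rightarrow> real \<Rightarrow> real \<Rightarrow> real"
    where "L x = cutoff_harmonic 3 R (\<lambda>k. fst x $ of_nat k) (\<lambda>k. snd x $ of_nat k)" for x
  have lin: "linear L"
    by (rule linearI) (auto simp: L_def cutoff_harmonic_def harmonic_eq fun_eq_iff scaleR_fun_def
        algebra_simps sum.distrib sum_distrib_left)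
  have neg: "enneper_Q 5 R (L x) < 0" if "x \<noteq> 0" for x
  proof -
    have "fst x \<noteq> 0 \<or> snd x \<noteq> 0" using that by (simp add: prod_eq_iff)
    then obtain j where j: "j \<in> {1..3::nat}" "fst x $ of_nat j \<noteq> 0 \<or> snd x $ of_nat j \<noteq> 0"
      by (auto simp: vec_eq_iff forall_3 dest: spec[of _ 1] intro: that[of 1] that[of 2] that[of 3])
    let ?c = "\<lambda>k. ((fst x $ of_nat k)\<^sup>2 + (snd x $ of_nat k)\<^sup>2) * (real k * R ^ (2 * k) - integral {0..R} (weight k))"
    have "(\<Sum>k\<in>{1..3}. ?c k) < (\<Sum>k\<in>{1..3::nat}. 0)"
    proof (rule sum_strict_mono_ex1)
      show "\<forall>k\<in>{1..3}. ?c k \<le> 0"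
        using weight_dominates[OF R] by (auto intro!: mult_nonneg_nonpos simp: less_imp_le)
      have "?c j < 0"
        using weight_dominates[OF R j(1)] j(2) by (intro mult_pos_neg) (auto simp: sum_power2_gt_zero_iff)
      then show "\<exists>k\<in>{1..3}. ?c k < 0" using j(1) by blast
    qed simp
    moreover have "enneper_Q 5 R (L x) = pi * (\<Sum>k\<in>{1..3}. ?c k)"
      using R by (intro second_variation_harmonic) (auto simp: L_def cutoff_harmonic_def)
    ultimately show ?thesis by (simp add: mult_pos_neg)
  qed
  \<comment> \<open>Definiteness gives independence: a nonzero \<open>x\<close> with
    \<open>L x = 0\<close> would make the second variation of the zero function negative.\<close>
  have "inj L"
  proof (subst linear_injective_0[OF lin], intro allI impI, rule ccontr)
    fix x assume "L x = 0" "x \<noteq> 0"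
    moreover have "enneper_Q 5 R (0 :: real \<Rightarrow> real \<Rightarrow> real) = 0"
      using second_variation_harmonic[of R 0 0] R by (simp add: harmonic_eq)
    ultimately show False using neg by fastforce
  qed
  have "subspace (range L)"
    using linear_subspace_image[OF lin subspace_UNIV] .
  moreover have "range L \<subseteq> function_space R"
    using cutoff_harmonic_function_space by (auto simp: L_def)
  moreover have "enneper_Q 5 R \<phi> < 0" if "\<phi> \<in> range L" "\<phi> \<noteq> 0" for \<phi>
  proof -
    obtain x where "\<phi> = L x" using \<open>\<phi> \<in> range L\<close> by blast
    then show ?thesis using neg[of x] linear_0[OF lin] \<open>\<phi> \<noteq> 0\<close> by metis
  qed
  ultimately have "enat (dim (range L)) \<le> ind_b 5 R"
    unfolding ind_b_def by (intro SUP_upper) auto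
  moreover have "dim (range L) = 6"
  proof -
    have "dim (range L) = dim (UNIV :: ((real^3) \<times> (real^3)) set)"
      using \<open>inj L\<close> by (intro dim_image_eq lin) simp
    then show ?thesis by simp
  qed
  ultimately show ?thesis by (simp add: numeral_eq_enat)
qed

theorem theorem2p4:
  shows "\<exists>R\<^sub>0. max_embedded_radius 5 R\<^sub>0 \<and> 1.1616 \<le> R\<^sub>0 \<and> R\<^sub>0 < 1.1617 \<and>
    second_variation (enneper 5) ({0<..<R\<^sub>0} \<times> {0<..<pi / 3}) (\<lambda>u v. u * bump v 4.24 4.15) < 0 \<and>
    ind_b 5 R\<^sub>0 \<ge> 6"
proof -
  define R where "R = Inf (double_point_radii 5)"
  obtain r where r: "r \<in> double_point_radii 5" "r < 1.1617"
    by (rule double_point_radii_5_upper)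
  then have ne: "double_point_radii 5 \<noteq> {}" by blast
  have lower: "1.1616 \<le> R"
    unfolding R_def using ne double_point_radii_5_lower by (rule cInf_greatest)
  have "R \<le> r"
    unfolding R_def using r(1) double_point_radii_5_lower by (intro cInf_lower bdd_belowI)
  then have upper: "R < 1.1617" using r(2) by linarith
  have "max_embedded_radius 5 R"
    using max_embedded_radius_Inf[of 5] ne lower unfolding R_def by simp
  then show ?thesis
    using lower upper bump_destabilizes[OF lower upper] ind_b_ge_6[OF lower upper] by blast
qed

end
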